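(* Consider the controlled, partially observed Markov chain model, the conditional expectations $\mathbf{p}_{k|k},\mathbf{p}_{k|k-1},\mathbf{y}_{k|k-1}$, the innovations $\mu_k,\lambda_k$, the prediction error covariance $\mathbf{\Sigma}_{k|k-1}$ and the gain $\mathbf{G}_k=\mathbb{E}\{\mu_k\lambda_k^T|\mathcal{F}_{k-1}\}\big[\mathbb{E}\{\lambda_k\lambda_k^T|\mathcal{F}_{k-1}\}\big]^{-1}$ described in the context. Then $\mathbf{p}_{0|-1}=\pi$, and (almost surely) $$\mathbf{p}_{k|k-1}=\mathbf{P}\,\mathbf{p}_{k-1|k-1}\quad (k\ge 1),$$ $$\mathbf{y}_{k|k-1}=\mathcal{M}(\mathbf{u}_{k-1})\,\mathbf{p}_{k|k-1}\quad (k\ge 0),$$ $$\mathbf{G}_k=\mathbf{\Sigma}_{k|k-1}\mathcal{M}^T(\mathbf{u}_{k-1})\big(\mathcal{M}(\mathbf{u}_{k-1})\mathbf{\Sigma}_{k|k-1}\mathcal{M}^T(\mathbf{u}_{k-1})+\widetilde{\mathbf{Q}}_k\big)^{-1}\quad (k\ge 0),$$ where $\widetilde{\mathbf{Q}}_k=\sum_{i=1}^n p^i_{k|k-1}\mathbf{Q}_i^{\mathbf{u}_{k-1}}$ and $p^i_{k|k-1}$ is the $i$-th component of $\mathbf{p}_{k|k-1}$. Consequently, when the Kalman-like relation $\mu_k=\mathbf{G}_k\lambda_k$ is imposed, the state estimate at time $k$ is given by $$\mathbf{p}_{k|k}=\mathbf{p}_{k|k-1}+\mathbf{G}_k[\mathbf{y}_k-\mathbf{y}_{k|k-1}],\quad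 k\ge 0,$$ with $\mathbf{p}_{k|k-1},\mathbf{y}_{k|k-1},\mathbf{G}_k$ given by the formulas above.
   Context: Model. $\mathbf{e}_1,\dots,\mathbf{e}_n$ are the standard unit vectors of $\mathbb{R}^n$ and $\mathcal{X}=\{\mathbf{e}_1,\dots,\mathbf{e}_n\}$. The state $(\mathbf{x}_k)_{k\ge0}$ takes values in $\mathcal{X}$, with initial distribution $\pi$ (a probability vector, $P(\mathbf{x}_0=\mathbf{e}_i)=\pi_i$). $\mathbf{P}$ is the $n\times n$ matrix whose $(j,i)$ entry is $P_{j|i}=P(\mathbf{x}_{k+1}=\mathbf{e}_j|\mathbf{x}_k=\mathbf{e}_i)$ (so columns sum to $1$). Controls $\mathbf{u}_k$ take values in a finite set $\mathcal{U}$. For each $\mathbf{u}\in\mathcal{U}$ and $i$, $\mathbf{m}_i^{\mathbf{u}}$ is a mean vector and $\mathbf{Q}_i^{\mathbf{u}}$ a (positive definite) covariance matrix, of dimension depending only on $\mathbf{u}$; $f(\cdot|\mathbf{e}_i,\mathbf{u})$ is the density of $\mathcal{N}(\mathbf{m}_i^{\mathbf{u}},\mathbf{Q}_i^{\mathbf{u}})$ and $\mathcal{M}(\mathbf{u})=[\mathbf{m}_1^{\mathbf{u}},\dots,\mathbf{m}_n^{\mathbf{u}}]$. Write $X^k,Y^k,U^k$ for the sequences up to time $k$ of states, observations and controls. The observation-control history is $\mathcal{F}_k=\sigma\{Y^k,U^{k-1}\}$, and each control is $\mathbf{u}_k=\eta_k(\mathcal{F}_k)$, i.e. a measurable function of $(Y^k,U^{k-1})$.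 The conditional law of $\mathbf{x}_{k+1}$ given $(X^k,Y^k,U^k)$ is that given by $\mathbf{P}$ and $\mathbf{x}_k$: $\mathbb{E}\{\mathbf{x}_{k+1}|X^k,Y^k,U^k\}=\mathbf{P}\mathbf{x}_k$. The conditional law of $\mathbf{y}_k$ given $(X^k,Y^{k-1},U^{k-1})$ has density $f(\cdot|\mathbf{x}_k,\mathbf{u}_{k-1})$. For $k=0$, $\mathbf{u}_{-1}\in\mathcal{U}$ is a fixed deterministic control and $\mathcal{F}_{-1}$ is the trivial $\sigma$-algebra. Notation. $\mathbf{p}_{k|s}=\mathbb{E}\{\mathbf{x}_k|\mathcal{F}_s\}$ (the vector of conditional probabilities $P(\mathbf{x}_k=\mathbf{e}_i|\mathcal{F}_s)$), $\mathbf{y}_{k|k-1}=\mathbb{E}\{\mathbf{y}_k|\mathcal{F}_{k-1}\}$, $\mu_k=\mathbf{p}_{k|k}-\mathbf{p}_{k|k-1}$, $\lambda_k=\mathbf{y}_k-\mathbf{y}_{k|k-1}$, and $\mathbf{\Sigma}_{k|k-1}=\mathbb{E}\{(\mathbf{x}_k-\mathbf{p}_{k|k-1})(\mathbf{x}_k-\mathbf{p}_{k|k-1})^T|\mathcal{F}_{k-1}\}$. The Kalman-like estimator is obtained by imposing, as an approximation treated as an equality, the relation $\mu_k=\mathbf{G}_k\lambda_k$ with $\mathbf{G}_k$ the ($\mathcal{F}_{k-1}$-measurable) gain displayed in the claim. *)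

theory Defs
  imports "HOL-Probability.Probability" "Jordan_Normal_Form.Gauss_Jordan_Elimination"
    "Jordan_Normal_Form.Determinant"
begin

no_notation inner (infix \<open>\<bullet>\<close> 70)
no_notation Finite_Cartesian_Product.vec.vec_nth (infixl \<open>$\<close> 90)
hide_type (open) Finite_Cartesian_Product.vec
hide_const (open) Finite_Cartesian_Product.vec

section \<open>Random vectors and matrices of variable dimension\<close>

text \<open>
  The dimension of an observation depends on the preceding control, so observations are
  random elements of the disjoint union of all the spaces \<open>\<real>\<^sup>d\<close>, that is, of the type
  \<^typ>\<open>real vec\<close>. Its \<open>\<sigma>\<close>-algebra is generated by the Borel boxes of each \<open>\<real>\<^sup>d\<close>.
\<close>

definition vec_borel :: "real vec measure" where
  "vec_borel = sigma UNIV
     {{v. dim_vec v = d \<and> (\<forall>i<d. v $ i \<in> B i)} | d B. \<forall>i. B i \<in> sets (borel :: real measure)}"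

definition vec_lborel :: "nat \<Rightarrow> real vec measure" where
  "vec_lborel d = distr (\<Pi>\<^sub>M i\<in>{..<d}. (lborel :: real measure)) vec_borel (vec d)"

lemma space_vec_borel [simp]: "space vec_borel = UNIV"
  by (simp add: vec_borel_def space_measure_of_conv)

lemma sets_vec_borel:
  "sets vec_borel = sigma_sets UNIV
     {{v. dim_vec v = d \<and> (\<forall>i<d. v $ i \<in> B i)} | d B. \<forall>i. B i \<in> sets (borel :: real measure)}"
  by (simp add: vec_borel_def sets_measure_of_conv)

text \<open>Without the following fact the \<^const>\<open>distr\<close> in \<open>vec_lborel\<close> would be the null measure.\<close>

lemma measurable_vec_vec_borel: "vec d \<in> (\<Pi>\<^sub>M i\<in>{..<d}. (lborel :: real measure)) \<rightarrow>\<^sub>M vec_borel"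
  unfolding vec_borel_def
proof (rule measurable_measure_of)
  let ?L = "\<Pi>\<^sub>M i\<in>{..<d}. (lborel :: real measure)"
  fix A :: "real vec set"
  assume "A \<in> {{v. dim_vec v = e \<and> (\<forall>i<e. v $ i \<in> B i)} | e B. \<forall>i. B i \<in> sets (borel :: real measure)}"
  then obtain e B where A: "A = {v. dim_vec v = e \<and> (\<forall>i<e. v $ i \<in> B i)}"
    and B: "\<And>i. B i \<in> sets (borel :: real measure)" by blast
  show "vec d -` A \<inter> space ?L \<in> sets ?L"
  proof (cases "d = e")
    case True
    have "vec d -` A \<inter> space ?L = (\<Pi>\<^sub>E i\<in>{..<d}. B i)"
      by (auto simp: A True space_PiM PiE_def Pi_def)
    moreover have "\<dots> \<in> sets ?L"
      by (rule sets_PiM_I_finite) (use B in auto)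
    ultimately show ?thesis by simp
  next
    case False
    then have "vec d -` A \<inter> space ?L = {}" by (auto simp: A)
    then show ?thesis by simp
  qed
qed auto

text \<open>
  Conditional expectations are taken entrywise. Entries beyond the random dimension are padded by
  \<open>0\<close> before conditioning and are cut off afterwards. Whenever the dimension is measurable with
  respect to the conditioning \<open>\<sigma>\<close>-algebra, this is the usual conditional expectation on each of
  the events on which the dimension is constant.
\<close>

definition vec_cond_exp :: "'w measure \<Rightarrow> 'w measure \<Rightarrow> ('w \<Rightarrow> real vec) \<Rightarrow> 'w \<Rightarrow> real vec" where
  "vec_cond_exp M F X \<omega> = vec (dim_vec (X \<omega>))
     (\<lambda>i. real_cond_exp M F (\<lambda>\<omega>'. if i < dim_vec (X \<omega>') then X \<omega>' $ i else 0) \<omega>)"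

definition mat_cond_exp :: "'w measure \<Rightarrow> 'w measure \<Rightarrow> ('w \<Rightarrow> real mat) \<Rightarrow> 'w \<Rightarrow> real mat" where
  "mat_cond_exp M F X \<omega> = mat (dim_row (X \<omega>)) (dim_col (X \<omega>))
     (\<lambda>(i, j). real_cond_exp M F
        (\<lambda>\<omega>'. if i < dim_row (X \<omega>') \<and> j < dim_col (X \<omega>') then X \<omega>' $$ (i, j) else 0) \<omega>)"

definition outer_prod :: "real vec \<Rightarrow> real vec \<Rightarrow> real mat" where
  "outer_prod v w = mat (dim_vec v) (dim_vec w) (\<lambda>(i, j). v $ i * w $ j)"

text \<open>Only to be used for invertible matrices; otherwise the value is unspecified.\<close>

definition mat_inv :: "real mat \<Rightarrow> real mat" where
  "mat_inv A = the (mat_inverse A)"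

definition pos_def_mat :: "nat \<Rightarrow> real mat \<Rightarrow> bool" where
  "pos_def_mat d A \<longleftrightarrow> A \<in> carrier_mat d d \<and> transpose_mat A = A \<and>
     (\<forall>v\<in>carrier_vec d. v \<noteq> 0\<^sub>v d \<longrightarrow> 0 < v \<bullet> (A *\<^sub>v v))"

definition gauss_density :: "real vec \<Rightarrow> real mat \<Rightarrow> real vec \<Rightarrow> real" where
  "gauss_density m Q z =
     exp (- ((z - m) \<bullet> (mat_inv Q *\<^sub>v (z - m))) / 2) / sqrt ((2 * pi) ^ dim_vec m * Determinant.det Q)"

definition gauss_law :: "real vec \<Rightarrow> real mat \<Rightarrow> real vec measure" where
  "gauss_law m Q = density (vec_lborel (dim_vec m)) (\<lambda>z. ennreal (gauss_density m Q z))"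


section \<open>The controlled, partially observed Markov chain\<close>

text \<open>
  The \<open>\<sigma>\<close>-algebra generated by \<open>x\<^sub>0,\<dots>,x\<^sub>a\<close>, \<open>y\<^sub>0,\<dots>,y\<^sub>b\<close> and \<open>u\<^sub>0,\<dots>,u\<^sub>c\<close>. The bounds are integers,
  so that a bound \<open>-1\<close> stands for the empty sequence. The deterministic control \<open>u\<^sub>-\<^sub>1\<close> contributes
  nothing.
\<close>

definition history ::
  "'w measure \<Rightarrow> (nat \<Rightarrow> 'w \<Rightarrow> real vec) \<Rightarrow> (nat \<Rightarrow> 'w \<Rightarrow> real vec) \<Rightarrow> (nat \<Rightarrow> 'w \<Rightarrow> 'u) \<Rightarrow>
   int \<Rightarrow> int \<Rightarrow> int \<Rightarrow> 'w measure" where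
  "history M x y u a b c = sigma (space M)
     ({x j -` A \<inter> space M | j A. int j \<le> a \<and> A \<in> sets vec_borel} \<union>
      {y j -` A \<inter> space M | j A. int j \<le> b \<and> A \<in> sets vec_borel} \<union>
      {u j -` A \<inter> space M | j A. int j \<le> c})"

text \<open>\<open>\<F>\<^sub>s = \<sigma>{Y\<^sup>s, U\<^bsup>s-1\<^esup>}\<close>; in particular \<open>\<F>\<^sub>-\<^sub>1\<close> is trivial.\<close>

definition obs_history ::
  "'w measure \<Rightarrow> (nat \<Rightarrow> 'w \<Rightarrow> real vec) \<Rightarrow> (nat \<Rightarrow> 'w \<Rightarrow> 'u) \<Rightarrow> int \<Rightarrow> 'w measure" where
  "obs_history M y u s = sigma (space M)
     ({y j -` A \<inter> space M | j A. int j \<le> s \<and> A \<in> sets vec_borel} \<union>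
      {u j -` A \<inter> space M | j A. int j \<le> s - 1})"

text \<open>The control \<open>u\<^bsub>k-1\<^esub>\<close>, where \<open>u\<^sub>-\<^sub>1 = u0\<close> is deterministic.\<close>

definition prev_control :: "'u \<Rightarrow> (nat \<Rightarrow> 'w \<Rightarrow> 'u) \<Rightarrow> nat \<Rightarrow> 'w \<Rightarrow> 'u" where
  "prev_control u0 u k \<omega> = (case k of 0 \<Rightarrow> u0 | Suc j \<Rightarrow> u j \<omega>)"

locale controlled_pomc = prob_space M
  for M :: "'w measure" +
  fixes n :: nat and P :: "real mat" and \<pi> :: "real vec"
    and U :: "'u set" and u0 :: 'u
    and d :: "'u \<Rightarrow> nat" and m :: "'u \<Rightarrow> nat \<Rightarrow> real vec" and Q :: "'u \<Rightarrow> nat \<Rightarrow> real mat"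
    and \<eta> :: "nat \<Rightarrow> (nat \<Rightarrow> real vec) \<times> (nat \<Rightarrow> 'u) \<Rightarrow> 'u"
    and x y :: "nat \<Rightarrow> 'w \<Rightarrow> real vec" and u :: "nat \<Rightarrow> 'w \<Rightarrow> 'u"
  assumes init_carrier: "\<pi> \<in> carrier_vec n"
    and init_nonneg: "\<And>i. i < n \<Longrightarrow> 0 \<le> \<pi> $ i"
    and init_sum: "(\<Sum>i<n. \<pi> $ i) = 1"
    and trans_carrier: "P \<in> carrier_mat n n"
    and trans_nonneg: "\<And>i j. i < n \<Longrightarrow> j < n \<Longrightarrow> 0 \<le> P $$ (j, i)"
    and trans_sum: "\<And>i. i < n \<Longrightarrow> (\<Sum>j<n. P $$ (j, i)) = 1"
    and finite_controls: "finite U"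
    and u0_in: "u0 \<in> U"
    and mean_carrier: "\<And>a i. a \<in> U \<Longrightarrow> i < n \<Longrightarrow> m a i \<in> carrier_vec (d a)"
    and cov_pos_def: "\<And>a i. a \<in> U \<Longrightarrow> i < n \<Longrightarrow> pos_def_mat (d a) (Q a i)"
    and state_measurable: "\<And>k. x k \<in> M \<rightarrow>\<^sub>M count_space (unit_vec n ` {..<n})"
    and control_measurable: "\<And>k. u k \<in> M \<rightarrow>\<^sub>M count_space U"
    and obs_measurable: "\<And>k. y k \<in> M \<rightarrow>\<^sub>M vec_borel"
    and obs_dim: "\<And>k \<omega>. \<omega> \<in> space M \<Longrightarrow> y k \<omega> \<in> carrier_vec (d (prev_control u0 u k \<omega>))"
    and init_law: "\<And>i. i < n \<Longrightarrow> prob {\<omega> \<in> space M. x 0 \<omega> = unit_vec n i} = \<pi> $ i"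
    and policy_measurable: "\<And>k. \<eta> k \<in> (\<Pi>\<^sub>M j\<in>{..k}. vec_borel) \<Otimes>\<^sub>M (\<Pi>\<^sub>M j\<in>{..<k}. count_space U)
          \<rightarrow>\<^sub>M count_space U"
    and control_policy: "\<And>k \<omega>. \<omega> \<in> space M \<Longrightarrow>
          u k \<omega> = \<eta> k ((\<lambda>j\<in>{..k}. y j \<omega>), (\<lambda>j\<in>{..<k}. u j \<omega>))"
    and transition: "\<And>k. AE \<omega> in M.
          vec_cond_exp M (history M x y u (int k) (int k) (int k)) (x (Suc k)) \<omega> = P *\<^sub>v x k \<omega>"
    and observation: "\<And>k i A. i < n \<Longrightarrow> A \<in> sets vec_borel \<Longrightarrow> AE \<omega> in M. x k \<omega> = unit_vec n i \<longrightarrow>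
          real_cond_exp M (history M x y u (int k) (int k - 1) (int k - 1))
            (\<lambda>\<omega>'. indicator A (y k \<omega>')) \<omega> =
          measure (gauss_law (m (prev_control u0 u k \<omega>) i) (Q (prev_control u0 u k \<omega>) i)) A"


section \<open>Estimates, innovations and gain\<close>

text \<open>\<open>p\<^bsub>k|s\<^esub>\<close>, with \<open>s\<close> an integer to allow for \<open>p\<^bsub>0|-1\<^esub>\<close>\<close>

definition state_est ::
  "'w measure \<Rightarrow> (nat \<Rightarrow> 'w \<Rightarrow> real vec) \<Rightarrow> (nat \<Rightarrow> 'w \<Rightarrow> real vec) \<Rightarrow> (nat \<Rightarrow> 'w \<Rightarrow> 'u) \<Rightarrow>
   nat \<Rightarrow> int \<Rightarrow> 'w \<Rightarrow> real vec" where
  "state_est M x y u k s = vec_cond_exp M (obs_history M y u s) (x k)"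

text \<open>\<open>y\<^bsub>k|k-1\<^esub>\<close>\<close>

definition obs_pred ::
  "'w measure \<Rightarrow> (nat \<Rightarrow> 'w \<Rightarrow> real vec) \<Rightarrow> (nat \<Rightarrow> 'w \<Rightarrow> 'u) \<Rightarrow> nat \<Rightarrow> 'w \<Rightarrow> real vec" where
  "obs_pred M y u k = vec_cond_exp M (obs_history M y u (int k - 1)) (y k)"

text \<open>\<open>\<mu>\<^sub>k\<close>\<close>

definition state_innov ::
  "'w measure \<Rightarrow> (nat \<Rightarrow> 'w \<Rightarrow> real vec) \<Rightarrow> (nat \<Rightarrow> 'w \<Rightarrow> real vec) \<Rightarrow> (nat \<Rightarrow> 'w \<Rightarrow> 'u) \<Rightarrow>
   nat \<Rightarrow> 'w \<Rightarrow> real vec" where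
  "state_innov M x y u k \<omega> = state_est M x y u k (int k) \<omega> - state_est M x y u k (int k - 1) \<omega>"

text \<open>\<open>\<lambda>\<^sub>k\<close>\<close>

definition obs_innov ::
  "'w measure \<Rightarrow> (nat \<Rightarrow> 'w \<Rightarrow> real vec) \<Rightarrow> (nat \<Rightarrow> 'w \<Rightarrow> 'u) \<Rightarrow> nat \<Rightarrow> 'w \<Rightarrow> real vec" where
  "obs_innov M y u k \<omega> = y k \<omega> - obs_pred M y u k \<omega>"

text \<open>\<open>\<Sigma>\<^bsub>k|k-1\<^esub>\<close>\<close>

definition pred_cov ::
  "'w measure \<Rightarrow> (nat \<Rightarrow> 'w \<Rightarrow> real vec) \<Rightarrow> (nat \<Rightarrow> 'w \<Rightarrow> real vec) \<Rightarrow> (nat \<Rightarrow> 'w \<Rightarrow> 'u) \<Rightarrow>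
   nat \<Rightarrow> 'w \<Rightarrow> real mat" where
  "pred_cov M x y u k = mat_cond_exp M (obs_history M y u (int k - 1))
     (\<lambda>\<omega>. outer_prod (x k \<omega> - state_est M x y u k (int k - 1) \<omega>)
                     (x k \<omega> - state_est M x y u k (int k - 1) \<omega>))"

text \<open>\<open>E{\<lambda>\<^sub>k \<lambda>\<^sub>k\<^sup>T | \<F>\<^bsub>k-1\<^esub>}\<close>\<close>

definition innov_cov ::
  "'w measure \<Rightarrow> (nat \<Rightarrow> 'w \<Rightarrow> real vec) \<Rightarrow> (nat \<Rightarrow> 'w \<Rightarrow> 'u) \<Rightarrow> nat \<Rightarrow> 'w \<Rightarrow> real mat" where
  "innov_cov M y u k = mat_cond_exp M (obs_history M y u (int k - 1))
     (\<lambda>\<omega>. outer_prod (obs_innov M y u k \<omega>) (obs_innov M y u k \<omega>))"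

definition gain ::
  "'w measure \<Rightarrow> (nat \<Rightarrow> 'w \<Rightarrow> real vec) \<Rightarrow> (nat \<Rightarrow> 'w \<Rightarrow> real vec) \<Rightarrow> (nat \<Rightarrow> 'w \<Rightarrow> 'u) \<Rightarrow>
   nat \<Rightarrow> 'w \<Rightarrow> real mat" where
  "gain M x y u k \<omega> = mat_cond_exp M (obs_history M y u (int k - 1))
       (\<lambda>\<omega>. outer_prod (state_innov M x y u k \<omega>) (obs_innov M y u k \<omega>)) \<omega> *
     mat_inv (innov_cov M y u k \<omega>)"

text \<open>\<open>\<M>(a) = [m\<^sub>1\<^sup>a, \<dots>, m\<^sub>n\<^sup>a]\<close>\<close>

definition mean_mat ::
  "nat \<Rightarrow> ('u \<Rightarrow> nat) \<Rightarrow> ('u \<Rightarrow> nat \<Rightarrow> real vec) \<Rightarrow> 'u \<Rightarrow> real mat" where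
  "mean_mat n d m a = mat_of_cols (d a) (map (m a) [0..<n])"

text \<open>\<open>\<Sum>\<^sub>i p\<^sup>i Q\<^sub>i\<^sup>a\<close>\<close>

definition mix_cov ::
  "nat \<Rightarrow> ('u \<Rightarrow> nat) \<Rightarrow> ('u \<Rightarrow> nat \<Rightarrow> real mat) \<Rightarrow> real vec \<Rightarrow> 'u \<Rightarrow> real mat" where
  "mix_cov n d Q p a = mat (d a) (d a) (\<lambda>(r, c). \<Sum>i<n. p $ i * Q a i $$ (r, c))"

end

theory Submission
  imports Defs
begin

text \<open>
  All filter formulas come from one identity. Given \<open>x\<^sub>k = e\<^sub>i\<close> and the joint past, \<open>y\<^sub>k\<close> is
  Gaussian with parameters depending on \<open>u\<^bsub>k-1\<^esub>\<close> only, which is \<open>\<F>\<^bsub>k-1\<^esub>\<close>-measurable through the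
  policy. Hence the conditional expectation of \<open>x\<^sub>k\<^sup>i g(y\<^sub>k)\<close> given \<open>\<F>\<^bsub>k-1\<^esub>\<close> is \<open>p\<^sup>i\<^bsub>k|k-1\<^esub>\<close> times
  the Gaussian mean of \<open>g\<close>. Taking first and second moments for \<open>g\<close> gives \<open>y\<^bsub>k|k-1\<^esub>\<close> and the
  innovation covariance; the tower property through \<open>\<F>\<^sub>k\<close> replaces \<open>\<mu>\<^sub>k\<close> by \<open>x\<^sub>k - p\<^bsub>k|k-1\<^esub>\<close> in the
  cross covariance. The innovation covariance is positive definite because it is the covariance of
  a mixture of nondegenerate Gaussians. The Gaussian moments themselves follow by factoring
  \<open>Q = L D L\<^sup>T\<close> with \<open>L\<close> unitriangular, which turns the density into a product of
  one-dimensional normal densities by a volume preserving change of variables.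
\<close>

text \<open>The hypothesis on \<open>y k\<close> concerns one measurable set at a time and a law
  that varies with the random previous control, while the moments need unbounded integrands.
  Finiteness of \<open>U\<close> resolves both: the sample space is cut into the events {x_k = e_i,
  u_{k-1} = a}, on each of which the law is frozen. The image under \<open>y k\<close> of the
  probability restricted to such an event is a multiple of one Gaussian measure, so every integrable
  function transfers at once. The same finiteness bounds the conditional means uniformly, which
  makes products with them integrable without any L^2 theory of conditional expectation. The
  dimension of \<open>y k\<close> is random too. All scalar arguments therefore run on zero-padded
  coordinates (\<open>coord\<close>, \<open>mean\<close>, \<open>second\<close>), and vectors and
  matrices are reassembled only afterwards, at almost every single point.\<close>

section \<open>Gaussian moments\<close>

text \<open>Induction on the dimension, splitting off the Schur complement of the first diagonal entry.\<close>

lemma ldl_decomposition: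
  fixes q :: "nat \<Rightarrow> nat \<Rightarrow> real"
  assumes "\<And>i j. i < d \<Longrightarrow> j < d \<Longrightarrow> q i j = q j i"
    and "\<And>v. \<exists>i<d. v i \<noteq> 0 \<Longrightarrow> 0 < (\<Sum>i<d. \<Sum>j<d. v i * q i j * v j)"
  shows "\<exists>L D. (\<forall>i<d. 0 < D i) \<and> (\<forall>i. L i i = 1) \<and> (\<forall>i j. i < j \<longrightarrow> L i j = 0) \<and>
    (\<forall>i<d. \<forall>j<d. q i j = (\<Sum>k<d. L i k * D k * L j k))"
  using assms
proof (induction d arbitrary: q)
  case 0
  \<comment> \<open>The unit diagonal is required at all indices, also beyond \<open>d\<close>, so
    the identity serves as \<open>L\<close>.\<close>
  show ?case by (rule exI[of _ "\<lambda>i j. if i = j then 1 else 0"]) auto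
next
  case (Suc d)
  define a where "a = q 0 0"
  \<comment> \<open>Testing with the first unit vector makes the pivot \<open>a\<close>
    positive.\<close>
  have "0 < (\<Sum>i<Suc d. \<Sum>j<Suc d. (if i = 0 then 1 else 0) * q i j * (if j = 0 then 1 else 0))"
    by (rule Suc.prems(2)) auto
  then have a: "a > 0"
    by (simp add: sum.lessThan_Suc_shift a_def del: sum.lessThan_Suc)
  have sym0: "q (Suc i) 0 = q 0 (Suc i)" if "i < d" for i using Suc.prems(1)[of "Suc i" 0] that by simp
  define s where "s i j = q (Suc i) (Suc j) - q 0 (Suc i) * q 0 (Suc j) / a" for i j
  have "\<exists>L D. (\<forall>i<d. 0 < D i) \<and> (\<forall>i. L i i = 1) \<and> (\<forall>i j. i < j \<longrightarrow> L i j = 0) \<and>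
    (\<forall>i<d. \<forall>j<d. s i j = (\<Sum>k<d. L i k * D k * L j k))"
  proof (rule Suc.IH)
    fix i j assume "i < d" "j < d"
    then show "s i j = s j i" using Suc.prems(1)[of "Suc i" "Suc j"] by (simp add: s_def)
  next
    fix v :: "nat \<Rightarrow> real" assume v: "\<exists>i<d. v i \<noteq> 0"
    define \<beta> where "\<beta> = (\<Sum>j<d. q 0 (Suc j) * v j)"
    \<comment> \<open>Prepending \<open>- \<beta> / a\<close> minimizes the quadratic form over the
      first coordinate; the minimum is the form of the Schur complement \<open>s\<close> at
      \<open>v\<close>.\<close>
    define w where "w = case_nat (- \<beta> / a) v"
    have "0 < (\<Sum>i<Suc d. \<Sum>j<Suc d. w i * q i j * w j)"
    proof (rule Suc.prems(2))
      show "\<exists>i<Suc d. w i \<noteq> 0" using v by (metis Suc_less_eq nat.case(2) w_def)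
    qed
    also have "\<dots> = (\<Sum>j<Suc d. w 0 * q 0 j * w j) + (\<Sum>i<d. \<Sum>j<Suc d. v i * q (Suc i) j * w j)"
      by (simp only: sum.lessThan_Suc_shift[of _ d]) (simp add: w_def)
    also have "(\<Sum>j<Suc d. w 0 * q 0 j * w j) = w 0 * a * w 0 + w 0 * \<beta>"
      by (simp only: sum.lessThan_Suc_shift[of _ d]) (simp add: w_def a_def \<beta>_def sum_distrib_left sum_negf sum_divide_distrib mult_ac)
    also have "\<dots> = \<beta>\<^sup>2 / a - \<beta> / a * \<beta>"
      using a by (simp add: w_def power2_eq_square)
    also have "(\<Sum>i<d. \<Sum>j<Suc d. v i * q (Suc i) j * w j) =
        (\<Sum>i<d. v i * q 0 (Suc i) * (- \<beta> / a) + (\<Sum>j<d. v i * q (Suc i) (Suc j) * v j))"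
      by (intro sum.cong refl, simp only: sum.lessThan_Suc_shift[of _ d]) (simp add: w_def sym0)
    also have "\<dots> = - \<beta> / a * \<beta> + (\<Sum>i<d. \<Sum>j<d. v i * q (Suc i) (Suc j) * v j)"
    proof -
      have "(\<Sum>i<d. v i * q 0 (Suc i)) = \<beta>" by (simp add: \<beta>_def mult.commute)
      then show ?thesis by (simp only: sum.distrib sum_distrib_right[symmetric]) simp
    qed
    finally have "0 < (\<Sum>i<d. \<Sum>j<d. v i * q (Suc i) (Suc j) * v j) - \<beta> * \<beta> / a"
      by (simp add: power2_eq_square)
    also have "\<dots> = (\<Sum>i<d. \<Sum>j<d. v i * s i j * v j)"
    proof -
      have "\<beta> * \<beta> / a = (\<Sum>i<d. \<Sum>j<d. v i * (q 0 (Suc i) * q 0 (Suc j) / a) * v j)"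
        by (simp add: \<beta>_def sum_product sum_divide_distrib mult_ac)
      then show ?thesis
        by (simp only: sum_subtractf[symmetric])
          (intro sum.cong refl, simp add: s_def right_diff_distrib left_diff_distrib)
    qed
    finally show "0 < (\<Sum>i<d. \<Sum>j<d. v i * s i j * v j)" .
  qed
  then obtain L D where LD: "(\<forall>i<d. 0 < D i) \<and> (\<forall>i. L i i = 1) \<and> (\<forall>i j. i < j \<longrightarrow> L i j = 0) \<and>
    (\<forall>i<d. \<forall>j<d. s i j = (\<Sum>k<d. L i k * D k * L j k))"
    by blast
  then have D: "\<And>i. i < d \<Longrightarrow> 0 < D i" and L: "\<And>i. L i i = 1" "\<And>i j. i < j \<Longrightarrow> L i j = 0"
    and s: "\<And>i j. i < d \<Longrightarrow> j < d \<Longrightarrow> s i j = (\<Sum>k<d. L i k * D k * L j k)"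
    by auto
  \<comment> \<open>One step of Gaussian elimination: the new first column holds the multipliers,
    and the factor of the Schur complement is shifted by one index.\<close>
  define L' where "L' i j = (case i of 0 \<Rightarrow> if j = 0 then 1 else 0
     | Suc i' \<Rightarrow> (case j of 0 \<Rightarrow> q 0 (Suc i') / a | Suc j' \<Rightarrow> L i' j'))" for i j
  define D' where "D' = case_nat a D"
  have "q i j = (\<Sum>k<Suc d. L' i k * D' k * L' j k)" if "i < Suc d" "j < Suc d" for i j
  proof -
    have "(\<Sum>k<Suc d. L' i k * D' k * L' j k) =
        L' i 0 * a * L' j 0 + (\<Sum>k<d. L' i (Suc k) * D k * L' j (Suc k))"
      by (simp only: sum.lessThan_Suc_shift[of _ d]) (simp add: D'_def)
    also have "\<dots> = q i j"
      using that a s sym0 by (cases i; cases j) (auto simp: L'_def a_def[symmetric] s[symmetric] s_def)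
    finally show ?thesis by simp
  qed
  moreover have "\<forall>i<Suc d. 0 < D' i" using D a by (auto simp: D'_def split: nat.split)
  moreover have "\<forall>i. L' i i = 1" "\<forall>i j. i < j \<longrightarrow> L' i j = 0"
    using L by (auto simp: L'_def split: nat.split)
  ultimately show ?case by blast
qed

lemma measurable_affine_PiM [measurable]:
  "(\<lambda>w. \<lambda>i\<in>{..<d}. m i + (\<Sum>k<e. L i k * w k)) \<in>
     (\<Pi>\<^sub>M i\<in>{..<e}. (lborel :: real measure)) \<rightarrow>\<^sub>M (\<Pi>\<^sub>M i\<in>{..<d}. (lborel :: real measure))"
  by (intro measurable_restrict) measurable

text \<open>Fubini and translation invariance, one coordinate at a time.\<close>

lemma nn_integral_unitriangular:
  fixes L :: "nat \<Rightarrow> nat \<Rightarrow> real"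
  assumes L: "\<And>i. L i i = 1" "\<And>i j. i < j \<Longrightarrow> L i j = 0"
    and "f \<in> borel_measurable (\<Pi>\<^sub>M i\<in>{..<d}. (lborel :: real measure))"
  shows "(\<integral>\<^sup>+w. f (\<lambda>i\<in>{..<d}. m i + (\<Sum>k<d. L i k * w k)) \<partial>(\<Pi>\<^sub>M i\<in>{..<d}. lborel)) =
    (\<integral>\<^sup>+z. f z \<partial>(\<Pi>\<^sub>M i\<in>{..<d}. (lborel :: real measure)))"
  using assms(3)
proof (induction d arbitrary: f)
  case 0
  show ?case by (intro nn_integral_cong) (auto simp: space_PiM)
next
  case (Suc d)
  interpret product_sigma_finite "\<lambda>i::nat. (lborel :: real measure)" by unfold_locales
  define T where "T d w = (\<lambda>i\<in>{..<d}. m i + (\<Sum>k<d. L i k * w k))" for d and w :: "nat \<Rightarrow> real"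
  have ins: "{..<Suc d} = insert d {..<d}" by auto
  note f[measurable] = Suc.prems
  have fm: "f \<in> borel_measurable (Pi\<^sub>M (insert d {..<d}) (\<lambda>i. lborel))" using f by (simp add: ins)
  have T[measurable]: "T e \<in> (\<Pi>\<^sub>M i\<in>{..<e}. lborel) \<rightarrow>\<^sub>M (\<Pi>\<^sub>M i\<in>{..<e}. lborel)" for e
    unfolding T_def by measurable
  have fT: "(\<lambda>w. f (T (Suc d) w)) \<in> borel_measurable (Pi\<^sub>M (insert d {..<d}) (\<lambda>i. lborel))"
    unfolding ins[symmetric] by measurable
  have upd[measurable]: "(\<lambda>(w, t). w(d := t)) \<in> ((\<Pi>\<^sub>M i\<in>{..<d}. lborel) \<Otimes>\<^sub>M lborel) \<rightarrow>\<^sub>M (\<Pi>\<^sub>M i\<in>{..<Suc d}. (lborel::real measure))"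
    unfolding ins by (rule measurable_add_dim)
  \<comment> \<open>The last variable enters only the last coordinate, with coefficient
    \<open>L d d = 1\<close>. The form \<open>c + 1 * t\<close> fits the one-dimensional affine
    substitution rule, whose Jacobian factor is then one.\<close>
  have Tupd: "T (Suc d) (w(d := t)) = (T d w)(d := (m d + (\<Sum>k<d. L d k * w k)) + 1 * t)" for w t
    by (rule ext) (auto simp: T_def L intro!: sum.cong)
  have fu[measurable]: "(\<lambda>t. f (z(d := t))) \<in> borel_measurable borel"
    if "z \<in> space (\<Pi>\<^sub>M i\<in>{..<d}. (lborel::real measure))" for z
  proof -
    have "(\<lambda>t. z(d := t)) \<in> lborel \<rightarrow>\<^sub>M (\<Pi>\<^sub>M i\<in>{..<Suc d}. (lborel::real measure))"
      using measurable_compose[OF measurable_Pair1'[OF that] upd] by simp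
    from measurable_compose[OF this f] show ?thesis by (simp add: fun_upd_def)
  qed
  have "(\<integral>\<^sup>+w. f (T (Suc d) w) \<partial>(\<Pi>\<^sub>M i\<in>{..<Suc d}. lborel)) =
     (\<integral>\<^sup>+w. (\<integral>\<^sup>+t. f (T (Suc d) (w(d := t))) \<partial>lborel) \<partial>(\<Pi>\<^sub>M i\<in>{..<d}. lborel))"
    unfolding ins by (rule product_nn_integral_insert[OF _ _ fT]) auto
  also have "\<dots> = (\<integral>\<^sup>+w. (\<integral>\<^sup>+t. f ((T d w)(d := t)) \<partial>lborel) \<partial>(\<Pi>\<^sub>M i\<in>{..<d}. lborel))"
  proof (rule nn_integral_cong)
    fix w :: "nat \<Rightarrow> real" assume w: "w \<in> space (\<Pi>\<^sub>M i\<in>{..<d}. (lborel::real measure))"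
    have "T d w \<in> space (\<Pi>\<^sub>M i\<in>{..<d}. (lborel::real measure))"
      using measurable_space[OF T w] .
    from nn_integral_real_affine[OF fu[OF this], of 1 "m d + (\<Sum>k<d. L d k * w k)"]
    show "(\<integral>\<^sup>+t. f (T (Suc d) (w(d := t))) \<partial>lborel) = (\<integral>\<^sup>+t. f ((T d w)(d := t)) \<partial>lborel)"
      by (simp only: Tupd) simp
  qed
  \<comment> \<open>The integrand now depends on \<open>w\<close> through \<open>T d w\<close>
    alone, so the induction hypothesis applies to the inner integral as a function of the first
    \<open>d\<close> coordinates.\<close>
  also have "\<dots> = (\<integral>\<^sup>+z. (\<integral>\<^sup>+t. f (z(d := t)) \<partial>lborel) \<partial>(\<Pi>\<^sub>M i\<in>{..<d}. lborel))"
    unfolding T_def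
    by (rule Suc.IH, rule lborel.borel_measurable_nn_integral)
      (use measurable_compose[OF upd f] in \<open>simp add: split_beta'\<close>)
  also have "\<dots> = (\<integral>\<^sup>+z. f z \<partial>(\<Pi>\<^sub>M i\<in>{..<Suc d}. lborel))"
    unfolding ins by (rule product_nn_integral_insert[OF _ _ fm, symmetric]) auto
  finally show ?case unfolding T_def .
qed

section \<open>Measurability on the disjoint union of the spaces R^d\<close>

lemma sets_vec_borel_box:
  assumes "\<And>i. i < e \<Longrightarrow> B i \<in> sets (borel :: real measure)"
  shows "{v. dim_vec v = e \<and> (\<forall>i<e. v $ i \<in> B i)} \<in> sets vec_borel"
proof -
  \<comment> \<open>The generators ask for a Borel set at every index; those beyond the box receive
    \<open>UNIV\<close>.\<close>
  have "{v. dim_vec v = e \<and> (\<forall>i<e. v $ i \<in> B i)} =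
        {v. dim_vec v = e \<and> (\<forall>i<e. v $ i \<in> (if i < e then B i else UNIV))}" by auto
  also have "\<dots> \<in> sets vec_borel"
    unfolding sets_vec_borel using assms by (intro sigma_sets.Basic) (auto intro!: exI[of _ e] exI[of _ "\<lambda>i. if i < e then B i else UNIV"])
  finally show ?thesis .
qed

lemma measurable_dim_vec [measurable]: "dim_vec \<in> vec_borel \<rightarrow>\<^sub>M count_space UNIV"
proof (subst measurable_count_space_eq_countable, simp, safe)
  fix e show "dim_vec -` {e} \<inter> space vec_borel \<in> sets vec_borel"
    using sets_vec_borel_box[of e "\<lambda>_. UNIV"] by (simp add: vimage_def)
qed auto

text \<open>Makes evaluation at \<open>i\<close> measurable even on vectors too short to have such
  an entry: the unspecified value depends on the dimension alone.\<close>

lemma vec_index_outside: "dim_vec v \<le> i \<Longrightarrow> v $ i = undef_vec (i - dim_vec v)"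
  by transfer (auto simp: mk_vec_def)

lemma measurable_vec_index [measurable]: "(\<lambda>v. v $ i) \<in> borel_measurable vec_borel"
proof (rule measurableI)
  fix B :: "real set" assume B: "B \<in> sets borel"
  have "{v :: real vec. dim_vec v = e \<and> v $ i \<in> B} \<in> sets vec_borel" for e
  proof (cases "i < e")
    case True
    then have "{v :: real vec. dim_vec v = e \<and> v $ i \<in> B} =
        {v. dim_vec v = e \<and> (\<forall>j<e. v $ j \<in> (if j = i then B else UNIV))}" by auto
    also have "\<dots> \<in> sets vec_borel" using B by (intro sets_vec_borel_box) auto
    finally show ?thesis .
  next
    case False
    then have "{v :: real vec. dim_vec v = e \<and> v $ i \<in> B} =
        {v. dim_vec v = e \<and> (\<forall>j<e. v $ j \<in> UNIV)} \<inter>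
        (if (undef_vec (i - e) :: real) \<in> B then UNIV else {})"
      by (auto simp: vec_index_outside)
    also have "\<dots> \<in> sets vec_borel" using sets_vec_borel_box[of e "\<lambda>_. UNIV"] by auto
    finally show ?thesis .
  qed
  then have "(\<Union>e. {v :: real vec. dim_vec v = e \<and> v $ i \<in> B}) \<in> sets vec_borel" by blast
  also have "(\<Union>e. {v :: real vec. dim_vec v = e \<and> v $ i \<in> B}) = (\<lambda>v. v $ i) -` B \<inter> space vec_borel" by auto
  finally show "(\<lambda>v. v $ i) -` B \<inter> space vec_borel \<in> sets vec_borel" .
qed auto

lemma measurable_gauss_density [measurable]:
  assumes "Q \<in> carrier_mat (dim_vec m) (dim_vec m)" "mat_inv Q \<in> carrier_mat (dim_vec m) (dim_vec m)"
  shows "gauss_density m Q \<in> borel_measurable vec_borel"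
proof -
  \<comment> \<open>Valid for \<open>z\<close> of any dimension, since \<open>z - m\<close> takes
    its length from \<open>m\<close>.\<close>
  have "gauss_density m Q = (\<lambda>z. exp (- (\<Sum>i<dim_vec m. (z $ i - m $ i) *
      (\<Sum>j<dim_vec m. mat_inv Q $$ (i, j) * (z $ j - m $ j))) / 2) /
      sqrt ((2 * pi) ^ dim_vec m * Determinant.det Q))"
    using assms(2) unfolding gauss_density_def
    by (intro ext arg_cong2[of _ _ _ _ "(/)"] arg_cong[of _ _ exp] arg_cong[of _ _ uminus] refl)
      (auto simp: scalar_prod_def atLeast0LessThan intro!: sum.cong)
  also have "\<dots> \<in> borel_measurable vec_borel" by measurable
  finally show ?thesis .
qed

section \<open>Determinants, inverses and positivity of matrices\<close>

lemma prod_list_diag_lessThan: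
  "A \<in> carrier_mat n n \<Longrightarrow> prod_list (diag_mat A) = (\<Prod>i<n. A $$ (i, i))"
  by (auto simp: prod_list_diag_prod atLeast0LessThan)

lemma mat_inv:
  assumes "A \<in> carrier_mat n n" "Determinant.det A \<noteq> 0"
  shows "mat_inv A \<in> carrier_mat n n" "A * mat_inv A = 1\<^sub>m n" "mat_inv A * A = 1\<^sub>m n"
proof -
  obtain B where "mat_inverse A = Some B"
    using mat_inverse(1)[OF assms(1)] det_non_zero_imp_unit[OF assms] by fastforce
  with mat_inverse(2)[OF assms(1) this] show "mat_inv A \<in> carrier_mat n n" "A * mat_inv A = 1\<^sub>m n" "mat_inv A * A = 1\<^sub>m n"
    by (auto simp: mat_inv_def)
qed

lemma pos_def_mat_quadratic_form:
  assumes "pos_def_mat d A" "\<exists>i<d. v i \<noteq> 0"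
  shows "0 < (\<Sum>i<d. \<Sum>j<d. v i * A $$ (i, j) * v j)"
proof -
  have A: "A \<in> carrier_mat d d" using assms by (simp add: pos_def_mat_def)
  have "vec d v \<noteq> 0\<^sub>v d" using assms(2) by (metis index_vec index_zero_vec(1))
  then have "0 < vec d v \<bullet> (A *\<^sub>v vec d v)" using assms(1) by (simp add: pos_def_mat_def)
  also have "\<dots> = (\<Sum>i<d. \<Sum>j<d. v i * A $$ (i, j) * v j)"
    using A by (simp add: scalar_prod_def atLeast0LessThan sum_distrib_left mult_ac)
  finally show ?thesis .
qed

lemma det_nonzero_if_positive:
  fixes A :: "real mat"
  assumes A: "A \<in> carrier_mat d d"
    and pos: "\<And>v. v \<in> carrier_vec d \<Longrightarrow> v \<noteq> 0\<^sub>v d \<Longrightarrow> 0 < v \<bullet> (A *\<^sub>v v)"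
  shows "Determinant.det A \<noteq> 0"
proof
  assume "Determinant.det A = 0"
  then obtain v where v: "v \<in> carrier_vec d" "v \<noteq> 0\<^sub>v d" "A *\<^sub>v v = 0\<^sub>v d"
    using det_0_iff_vec_prod_zero[OF A] by auto
  from pos[OF v(1,2)] v show False by simp
qed

lemma sqrt_prod: "sqrt (prod f A) = (\<Prod>x\<in>A. sqrt (f x))"
  by (induction A rule: infinite_finite_induct) (auto simp: real_sqrt_mult)

text \<open>One factorization is fixed so that density, law and all moments refer to the same
  \<open>L\<close> and \<open>D\<close>; its existence is supplied by
  \<open>ldl_decomposition\<close> in \<open>gauss_law_moments\<close>.\<close>

locale gauss_factorization =
  fixes d :: nat and m :: "real vec" and Q :: "real mat"
    and L :: "nat \<Rightarrow> nat \<Rightarrow> real" and D :: "nat \<Rightarrow> real"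
  assumes m: "m \<in> carrier_vec d" and Q: "pos_def_mat d Q"
    and D_pos: "\<And>i. i < d \<Longrightarrow> 0 < D i"
    and L: "\<And>i. L i i = 1" "\<And>i j. i < j \<Longrightarrow> L i j = 0"
    and Q_eq: "\<And>i j. i < d \<Longrightarrow> j < d \<Longrightarrow> Q $$ (i, j) = (\<Sum>k<d. L i k * D k * L j k)"
begin

abbreviation Leb :: "(nat \<Rightarrow> real) measure" where
  "Leb \<equiv> \<Pi>\<^sub>M i\<in>{..<d}. (lborel :: real measure)"

text \<open>Carries independent centred normals with variances \<open>D k\<close>, whose joint
  density is \<open>weight\<close>, to the Gaussian law with mean \<open>m\<close> and covariance
  \<open>Q\<close>.\<close>

definition affine :: "(nat \<Rightarrow> real) \<Rightarrow> nat \<Rightarrow> real" where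
  "affine w = (\<lambda>i\<in>{..<d}. m $ i + (\<Sum>k<d. L i k * w k))"

definition weight :: "(nat \<Rightarrow> real) \<Rightarrow> real" where
  "weight w = (\<Prod>k<d. normal_density 0 (sqrt (D k)) (w k))"

lemma Q_carrier: "Q \<in> carrier_mat d d" using Q by (simp add: pos_def_mat_def)
lemma dim_m: "dim_vec m = d" using m by simp

lemma measurable_affine [measurable]: "affine \<in> Leb \<rightarrow>\<^sub>M Leb"
  unfolding affine_def by measurable

lemma measurable_weight [measurable]: "weight \<in> borel_measurable Leb"
  unfolding weight_def by measurable

lemma measurable_vec [measurable]: "vec d \<in> Leb \<rightarrow>\<^sub>M vec_borel"
  by (rule measurable_vec_vec_borel)

definition "Lm = mat d d (\<lambda>(i, j). L i j)"
definition "Dm = mat d d (\<lambda>(i, j). if i = j then D i else 0)"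

lemma carriers [simp]: "Lm \<in> carrier_mat d d" "Dm \<in> carrier_mat d d"
  by (auto simp: Lm_def Dm_def)

lemma Q_mat: "Q = Lm * (Dm * transpose_mat Lm)"
  using Q_carrier
  by (intro eq_matI)
    (auto simp: Lm_def Dm_def scalar_prod_def atLeast0LessThan Q_eq mult_ac if_distrib if_distribR cong: if_cong intro!: sum.cong)

lemma det_Lm: "Determinant.det Lm = 1"
proof -
  have "Determinant.det Lm = prod_list (diag_mat Lm)"
    by (rule det_lower_triangular[of d]) (auto simp: Lm_def L)
  also have "\<dots> = 1" by (subst prod_list_diag_lessThan[of _ d]) (auto simp: Lm_def L)
  finally show ?thesis .
qed

lemma det_Q: "Determinant.det Q = (\<Prod>k<d. D k)"
proof -
  have "Determinant.det Dm = prod_list (diag_mat Dm)"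
    by (rule det_lower_triangular[of d]) (auto simp: Dm_def)
  also have "\<dots> = (\<Prod>k<d. D k)" by (subst prod_list_diag_lessThan[of _ d]) (auto simp: Dm_def)
  moreover have "transpose_mat Lm \<in> carrier_mat d d" by simp
  note det_mult[OF carriers(1) mult_carrier_mat[OF carriers(2) this]] det_mult[OF carriers(2) this]
    det_transpose[OF carriers(1)]
  ultimately show ?thesis unfolding Q_mat by (simp add: det_Lm)
qed

lemma Q_inv: "mat_inv Q \<in> carrier_mat d d" "Q * mat_inv Q = 1\<^sub>m d"
  using mat_inv[OF Q_carrier det_nonzero_if_positive[OF Q_carrier]] Q by (auto simp: pos_def_mat_def)

text \<open>Unit determinant makes \<open>Lm\<close> invertible; this is what cancels the outer
  factor when a system with matrix \<open>Q\<close> is solved.\<close>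

lemma Lm_inj:
  assumes "v \<in> carrier_vec d" "w \<in> carrier_vec d" "Lm *\<^sub>v v = Lm *\<^sub>v w"
  shows "v = w"
proof -
  have inv: "mat_inv Lm \<in> carrier_mat d d" "mat_inv Lm * Lm = 1\<^sub>m d"
    using mat_inv[OF carriers(1)] det_Lm by auto
  have "mat_inv Lm *\<^sub>v (Lm *\<^sub>v v) = v" if "v \<in> carrier_vec d" for v
    using that assoc_mult_mat_vec[OF inv(1) carriers(1) that] by (simp add: inv(2))
  then show ?thesis using assms by metis
qed

text \<open>With \<open>Q = L D L\<^sup>T\<close> and \<open>g = Q\<inverse> L w\<close>, injectivity of \<open>L\<close> gives \<open>D L\<^sup>T g = w\<close>.\<close>

lemma quadratic_form_affine:
  "(vec d (affine w) - m) \<bullet> (mat_inv Q *\<^sub>v (vec d (affine w) - m)) = (\<Sum>k<d. (w k)\<^sup>2 / D k)"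
proof -
  define v where "v = vec d w"
  have v [simp]: "v \<in> carrier_vec d" by (simp add: v_def)
  have z: "vec d (affine w) - m = Lm *\<^sub>v v"
    using m by (intro eq_vecI) (auto simp: affine_def Lm_def v_def scalar_prod_def atLeast0LessThan)
  define g where "g = mat_inv Q *\<^sub>v (Lm *\<^sub>v v)"
  have g [simp]: "g \<in> carrier_vec d"
    unfolding g_def by (rule mult_mat_vec_carrier[OF Q_inv(1) mult_mat_vec_carrier[OF carriers(1) v]])
  have dim_g: "dim_vec g = d" using g by (rule carrier_vecD)
  have Lv: "Lm *\<^sub>v v \<in> carrier_vec d" by (rule mult_mat_vec_carrier[of _ d d]) auto
  have "Q *\<^sub>v g = (Q * mat_inv Q) *\<^sub>v (Lm *\<^sub>v v)"
    unfolding g_def by (rule assoc_mult_mat_vec[OF Q_carrier Q_inv(1) Lv, symmetric])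
  also have "\<dots> = Lm *\<^sub>v v" using Lv by (simp add: Q_inv)
  finally have Qg: "Q *\<^sub>v g = Lm *\<^sub>v v" .
  have LTg: "transpose_mat Lm *\<^sub>v g \<in> carrier_vec d" by (rule mult_mat_vec_carrier[of _ d d]) auto
  have "Lm *\<^sub>v (Dm *\<^sub>v (transpose_mat Lm *\<^sub>v g)) = Q *\<^sub>v g"
  proof -
    have LT: "transpose_mat Lm \<in> carrier_mat d d" by simp
    have "Q *\<^sub>v g = Lm *\<^sub>v ((Dm * transpose_mat Lm) *\<^sub>v g)"
      unfolding Q_mat by (rule assoc_mult_mat_vec[OF carriers(1) mult_carrier_mat[OF carriers(2) LT] g])
    also have "(Dm * transpose_mat Lm) *\<^sub>v g = Dm *\<^sub>v (transpose_mat Lm *\<^sub>v g)"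
      by (rule assoc_mult_mat_vec[OF carriers(2) LT g])
    finally show ?thesis ..
  qed
  then have "Dm *\<^sub>v (transpose_mat Lm *\<^sub>v g) = v"
    unfolding Qg by (rule Lm_inj[OF mult_mat_vec_carrier[OF carriers(2) LTg] v])
  then have "(Dm *\<^sub>v (transpose_mat Lm *\<^sub>v g)) $ k = w k" if "k < d" for k
    using that by (simp add: v_def)
  moreover have "(Dm *\<^sub>v (transpose_mat Lm *\<^sub>v g)) $ k = D k * (transpose_mat Lm *\<^sub>v g) $ k" if "k < d" for k
  proof -
    have "(Dm *\<^sub>v (transpose_mat Lm *\<^sub>v g)) $ k =
        (\<Sum>j<d. (if k = j then D k else 0) * (transpose_mat Lm *\<^sub>v g) $ j)"
      using that LTg by (simp add: Dm_def mult_mat_vec_def scalar_prod_def atLeast0LessThan del: index_mult_mat_vec)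
    also have "\<dots> = D k * (transpose_mat Lm *\<^sub>v g) $ k" using that by (simp add: if_distribR if_distrib cong: if_cong)
    finally show ?thesis .
  qed
  ultimately have "D k * (transpose_mat Lm *\<^sub>v g) $ k = w k" if "k < d" for k
    using that by simp
  then have comp: "(transpose_mat Lm *\<^sub>v g) $ k = w k / D k" if "k < d" for k
    using that D_pos[OF that] by (simp add: field_simps)
  have "(Lm *\<^sub>v v) \<bullet> g = (\<Sum>i<d. (\<Sum>k<d. L i k * w k) * g $ i)"
    unfolding scalar_prod_def dim_g by (simp add: Lm_def v_def scalar_prod_def atLeast0LessThan)
  also have "\<dots> = (\<Sum>k<d. w k * (\<Sum>i<d. L i k * g $ i))"
    unfolding sum_distrib_left sum_distrib_right by (subst sum.swap) (simp add: mult_ac)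
  also have "\<dots> = (\<Sum>k<d. w k * (transpose_mat Lm *\<^sub>v g) $ k)"
    by (simp add: Lm_def scalar_prod_def dim_g atLeast0LessThan)
  also have "\<dots> = (\<Sum>k<d. (w k)\<^sup>2 / D k)" by (simp add: comp power2_eq_square)
  finally show ?thesis unfolding z g_def .
qed

text \<open>In the coordinates \<open>w\<close> the exponent is a sum and \<open>det Q\<close> a
  product over the coordinates, so the normalizing constant splits into one-dimensional
  ones.\<close>

lemma gauss_density_affine: "gauss_density m Q (vec d (affine w)) = weight w"
proof -
  have "weight w = (\<Prod>k<d. exp (- ((w k)\<^sup>2 / D k) / 2) / sqrt (2 * pi * D k))"
    unfolding weight_def normal_density_def using D_pos by (intro prod.cong) (auto simp: less_imp_le)
  also have "\<dots> = (\<Prod>k<d. exp (- ((w k)\<^sup>2 / D k) / 2)) / (\<Prod>k<d. sqrt (2 * pi * D k))"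
    by (rule prod_dividef)
  also have "(\<Prod>k<d. exp (- ((w k)\<^sup>2 / D k) / 2)) = exp (- (\<Sum>k<d. (w k)\<^sup>2 / D k) / 2)"
    by (subst exp_sum[symmetric]) (auto simp: sum_divide_distrib sum_negf)
  also have "(\<Prod>k<d. sqrt (2 * pi * D k)) = sqrt (\<Prod>k<d. 2 * pi * D k)"
    by (simp add: sqrt_prod)
  also have "(\<Prod>k<d. 2 * pi * D k) = (2 * pi) ^ d * Determinant.det Q"
    by (simp add: prod.distrib det_Q)
  finally show ?thesis by (simp add: gauss_density_def quadratic_form_affine dim_m)
qed

lemma weight_nonneg: "0 \<le> weight w"
  unfolding weight_def by (intro prod_nonneg) (auto simp: normal_density_nonneg)

text \<open>The substitution preserves volume, hence no Jacobian appears. Moments of the Gaussian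
  law thereby become integrals of polynomials against a product density.\<close>

lemma gauss_law_eq: "gauss_law m Q = distr (density Leb (\<lambda>w. ennreal (weight w))) vec_borel (\<lambda>w. vec d (affine w))"
proof (rule measure_eqI)
  show "sets (gauss_law m Q) = sets (distr (density Leb (\<lambda>w. ennreal (weight w))) vec_borel (\<lambda>w. vec d (affine w)))"
    by (simp add: gauss_law_def vec_lborel_def)
  fix A assume "A \<in> sets (gauss_law m Q)"
  then have A [measurable]: "A \<in> sets vec_borel" by (simp add: gauss_law_def vec_lborel_def)
  have [measurable]: "gauss_density m Q \<in> borel_measurable vec_borel"
    using Q_carrier Q_inv(1) by (intro measurable_gauss_density) (simp_all add: dim_m)
  have "emeasure (gauss_law m Q) A = (\<integral>\<^sup>+z. ennreal (gauss_density m Q z) * indicator A z \<partial>vec_lborel d)"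
    unfolding gauss_law_def dim_m
    by (rule emeasure_density) (simp_all add: vec_lborel_def)
  also have "\<dots> = (\<integral>\<^sup>+z. ennreal (gauss_density m Q (vec d z)) * indicator A (vec d z) \<partial>Leb)"
    unfolding vec_lborel_def by (rule nn_integral_distr) measurable
  also have "\<dots> = (\<integral>\<^sup>+w. ennreal (gauss_density m Q (vec d (affine w))) * indicator A (vec d (affine w)) \<partial>Leb)"
    unfolding affine_def
    by (rule nn_integral_unitriangular[OF L, symmetric]) (auto intro!: borel_measurable_times_ennreal)
  also have "\<dots> = (\<integral>\<^sup>+w. ennreal (weight w) * indicator ((\<lambda>w. vec d (affine w)) -` A \<inter> space Leb) w \<partial>Leb)"
    by (intro nn_integral_cong) (auto simp: gauss_density_affine split: split_indicator)
  also have "\<dots> = emeasure (density Leb (\<lambda>w. ennreal (weight w))) ((\<lambda>w. vec d (affine w)) -` A \<inter> space Leb)"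
    by (rule emeasure_density[symmetric]) measurable
  also have "\<dots> = emeasure (distr (density Leb (\<lambda>w. ennreal (weight w))) vec_borel (\<lambda>w. vec d (affine w))) A"
    by (subst emeasure_distr) auto
  finally show "emeasure (gauss_law m Q) A = \<dots>" .
qed

lemma has_bochner_integral_gauss_law:
  assumes [measurable]: "g \<in> borel_measurable vec_borel"
    and "has_bochner_integral Leb (\<lambda>w. weight w * g (vec d (affine w))) (c :: real)"
  shows "has_bochner_integral (gauss_law m Q) g c"
proof -
  have "has_bochner_integral (density Leb (\<lambda>w. ennreal (weight w))) (\<lambda>w. g (vec d (affine w))) c"
    by (rule has_bochner_integral_density) (use assms(2) weight_nonneg in auto)
  then show ?thesis unfolding gauss_law_eq
    by (rule has_bochner_integral_distr[rotated 2]) measurable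
qed

text \<open>Independence: a monomial times a product density is a product of functions of single
  coordinates, so the integral factors.\<close>

lemma moment:
  assumes "\<And>k. k < d \<Longrightarrow> has_bochner_integral lborel (\<lambda>t. normal_density 0 (sqrt (D k)) t * t ^ e k) (\<nu> k)"
  shows "has_bochner_integral Leb (\<lambda>w. weight w * (\<Prod>k<d. w k ^ e k)) (\<Prod>k<d. \<nu> k)"
proof -
  interpret product_sigma_finite "\<lambda>i::nat. (lborel :: real measure)" by unfold_locales
  have "has_bochner_integral Leb (\<lambda>w. \<Prod>k<d. normal_density 0 (sqrt (D k)) (w k) * w k ^ e k) (\<Prod>k<d. \<nu> k)"
    unfolding has_bochner_integral_iff
  proof
    show "integrable Leb (\<lambda>w. \<Prod>k<d. normal_density 0 (sqrt (D k)) (w k) * w k ^ e k)"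
      by (rule product_integrable_prod) (use assms in \<open>auto simp: has_bochner_integral_iff\<close>)
    have "(\<integral>w. (\<Prod>k<d. normal_density 0 (sqrt (D k)) (w k) * w k ^ e k) \<partial>Leb) =
      (\<Prod>k<d. \<integral>t. normal_density 0 (sqrt (D k)) t * t ^ e k \<partial>lborel)"
      by (rule product_integral_prod) (use assms in \<open>auto simp: has_bochner_integral_iff\<close>)
    then show "(\<integral>w. (\<Prod>k<d. normal_density 0 (sqrt (D k)) (w k) * w k ^ e k) \<partial>Leb) = (\<Prod>k<d. \<nu> k)"
      using assms by (simp add: has_bochner_integral_iff)
  qed
  then show ?thesis by (simp add: weight_def prod.distrib)
qed

lemma normal_moments:
  assumes "k < d"
  shows "has_bochner_integral lborel (\<lambda>t. normal_density 0 (sqrt (D k)) t * t ^ 0) 1"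
    "has_bochner_integral lborel (\<lambda>t. normal_density 0 (sqrt (D k)) t * t ^ 1) 0"
    "has_bochner_integral lborel (\<lambda>t. normal_density 0 (sqrt (D k)) t * t ^ 2) (D k)"
  using normal_moment_even[of "sqrt (D k)" 0 0] normal_moment_odd[of "sqrt (D k)" 0 0]
    normal_moment_even[of "sqrt (D k)" 0 1] D_pos[OF assms]
  by (simp_all add: power2_eq_square)

lemma weight_moment_0: "has_bochner_integral Leb weight 1"
  using moment[of "\<lambda>_. 0" "\<lambda>_. 1"] normal_moments by simp

lemma weight_moment_1:
  assumes "a < d"
  shows "has_bochner_integral Leb (\<lambda>w. weight w * w a) 0"
proof -
  have "has_bochner_integral Leb (\<lambda>w. weight w * (\<Prod>k<d. w k ^ (if k = a then 1 else 0)))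
      (\<Prod>k<d. if k = a then 0 else 1)"
    by (rule moment) (use normal_moments in auto)
  moreover have "(\<Prod>k<d. w k ^ (if k = a then 1 else 0)) = w a" for w :: "nat \<Rightarrow> real"
    using assms by (simp add: if_distrib cong: if_cong)
  moreover have "(\<Prod>k<d. if k = a then 0 else 1) = (0 :: real)" using assms by (simp add: prod.delta)
  ultimately show ?thesis by simp
qed

lemma weight_moment_2:
  assumes "a < d" "b < d"
  shows "has_bochner_integral Leb (\<lambda>w. weight w * (w a * w b)) (if a = b then D a else 0)"
proof -
  \<comment> \<open>\<open>?e k\<close> counts the occurrences of \<open>k\<close> among
    \<open>a\<close> and \<open>b\<close>: for \<open>a = b\<close> a second moment appears,
    otherwise two first moments, which vanish.\<close>
  let ?e = "\<lambda>k. (if k = a then 1 else 0) + (if k = b then 1 else 0) :: nat"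
  have "has_bochner_integral Leb (\<lambda>w. weight w * (\<Prod>k<d. w k ^ ?e k))
      (\<Prod>k<d. if ?e k = 2 then D k else if ?e k = 1 then 0 else 1)"
    by (rule moment) (use normal_moments in \<open>auto simp: numeral_2_eq_2\<close>)
  moreover have "(\<Prod>k<d. w k ^ ?e k) = w a * w b" for w :: "nat \<Rightarrow> real"
    unfolding power_add prod.distrib using assms by (simp add: if_distrib cong: if_cong)
  moreover have "(\<Prod>k<d. if ?e k = 2 then D k else if ?e k = 1 then 0 else 1) = (if a = b then D a else 0)"
  proof (cases "a = b")
    case True
    then have "(\<Prod>k<d. if ?e k = 2 then D k else if ?e k = 1 then 0 else 1) = (\<Prod>k<d. if k = a then D k else 1)"
      by (intro prod.cong) auto
    then show ?thesis using True assms by simp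
  next
    case False
    then show ?thesis using assms by (auto intro!: prod_zero bexI[of _ a])
  qed
  ultimately show ?thesis by simp
qed

lemma weight_moment_linear:
  "has_bochner_integral Leb (\<lambda>w. weight w * (\<Sum>k<d. L r k * w k)) 0"
proof -
  have "has_bochner_integral Leb (\<lambda>w. \<Sum>k<d. L r k * (weight w * w k)) (\<Sum>k<d. L r k * 0)"
    by (intro has_bochner_integral_sum has_bochner_integral_mult_right weight_moment_1) auto
  then show ?thesis by (simp add: sum_distrib_left mult_ac)
qed

text \<open>Bilinear expansion: the mixed moments vanish, and the surviving variances assemble to an
  entry of \<open>L D L^T\<close>.\<close>

lemma weight_moment_quadratic:
  assumes "r < d" "c < d"
  shows "has_bochner_integral Leb (\<lambda>w. weight w * ((\<Sum>k<d. L r k * w k) * (\<Sum>k<d. L c k * w k))) (Q $$ (r, c))"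
proof -
  have "has_bochner_integral Leb (\<lambda>w. \<Sum>k<d. \<Sum>l<d. (L r k * L c l) * (weight w * (w k * w l)))
      (\<Sum>k<d. \<Sum>l<d. (L r k * L c l) * (if k = l then D k else 0))"
    by (intro has_bochner_integral_sum has_bochner_integral_mult_right weight_moment_2) auto
  moreover have "(\<Sum>k<d. \<Sum>l<d. (L r k * L c l) * (if k = l then D k else 0)) = Q $$ (r, c)"
    using assms by (simp add: Q_eq if_distrib mult_ac cong: if_cong)
  ultimately show ?thesis by (simp add: sum_product sum_distrib_left mult_ac)
qed

lemma gauss_law_total: "has_bochner_integral (gauss_law m Q) (\<lambda>_. 1) (1 :: real)"
  using has_bochner_integral_gauss_law[of "\<lambda>_. 1" 1] weight_moment_0 by simp

lemma gauss_law_mean: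
  assumes "r < d"
  shows "has_bochner_integral (gauss_law m Q) (\<lambda>z. z $ r) (m $ r)"
proof (rule has_bochner_integral_gauss_law)
  have "has_bochner_integral Leb (\<lambda>w. m $ r * weight w + weight w * (\<Sum>k<d. L r k * w k)) (m $ r * 1 + 0)"
    by (intro has_bochner_integral_add has_bochner_integral_mult_right weight_moment_0 weight_moment_linear)
  then show "has_bochner_integral Leb (\<lambda>w. weight w * vec d (affine w) $ r) (m $ r)"
    using assms by (simp add: affine_def algebra_simps)
qed measurable

lemma gauss_law_second_moment:
  assumes "r < d" "c < d"
  shows "has_bochner_integral (gauss_law m Q) (\<lambda>z. z $ r * z $ c) (Q $$ (r, c) + m $ r * m $ c)"
proof (rule has_bochner_integral_gauss_law)
  have "has_bochner_integral Leb (\<lambda>w. weight w * ((\<Sum>k<d. L r k * w k) * (\<Sum>k<d. L c k * w k)) +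
      (m $ r * m $ c) * weight w + m $ r * (weight w * (\<Sum>k<d. L c k * w k)) + m $ c * (weight w * (\<Sum>k<d. L r k * w k)))
      (Q $$ (r, c) + (m $ r * m $ c) * 1 + m $ r * 0 + m $ c * 0)"
    by (intro has_bochner_integral_add has_bochner_integral_mult_right weight_moment_0
        weight_moment_linear weight_moment_quadratic assms)
  then show "has_bochner_integral Leb (\<lambda>w. weight w * (vec d (affine w) $ r * vec d (affine w) $ c))
      (Q $$ (r, c) + m $ r * m $ c)"
    using assms by (simp add: affine_def algebra_simps)
qed measurable

end

text \<open>The conclusions mention only \<open>m\<close> and \<open>Q\<close>, so an arbitrary
  factorization may be chosen and forgotten again.\<close>

lemma gauss_law_moments:
  assumes "m \<in> carrier_vec d" "pos_def_mat d Q"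
  shows "has_bochner_integral (gauss_law m Q) (\<lambda>_. 1) (1 :: real)"
    and "\<And>r. r < d \<Longrightarrow> has_bochner_integral (gauss_law m Q) (\<lambda>z. z $ r) (m $ r)"
    and "\<And>r c. r < d \<Longrightarrow> c < d \<Longrightarrow>
      has_bochner_integral (gauss_law m Q) (\<lambda>z. z $ r * z $ c) (Q $$ (r, c) + m $ r * m $ c)"
proof -
  have "transpose_mat Q = Q" and Q: "Q \<in> carrier_mat d d" using assms(2) by (auto simp: pos_def_mat_def)
  then have "Q $$ (i, j) = Q $$ (j, i)" if "i < d" "j < d" for i j
    using that by (metis carrier_matD index_transpose_mat(1))
  from ldl_decomposition[of d "\<lambda>i j. Q $$ (i, j)", OF this pos_def_mat_quadratic_form[OF assms(2)]]
  obtain L D where "(\<forall>i<d. 0 < D i) \<and> (\<forall>i. L i i = 1) \<and> (\<forall>i j. i < j \<longrightarrow> L i j = 0) \<and>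
    (\<forall>i<d. \<forall>j<d. Q $$ (i, j) = (\<Sum>k<d. L i k * D k * L j k))"
    by blast
  then have "gauss_factorization d m Q L D"
    using assms by unfold_locales auto
  then interpret gauss_factorization d m Q L D .
  show "has_bochner_integral (gauss_law m Q) (\<lambda>_. 1) (1 :: real)" by (rule gauss_law_total)
  show "has_bochner_integral (gauss_law m Q) (\<lambda>z. z $ r) (m $ r)" if "r < d" for r
    using that by (rule gauss_law_mean)
  show "has_bochner_integral (gauss_law m Q) (\<lambda>z. z $ r * z $ c) (Q $$ (r, c) + m $ r * m $ c)"
    if "r < d" "c < d" for r c
    using that by (rule gauss_law_second_moment)
qed

section \<open>Covariance of a mixture\<close>

lemma scalar_prod_mult_mat_vec:
  assumes "A \<in> carrier_mat d d" "v \<in> carrier_vec d"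
  shows "v \<bullet> (A *\<^sub>v v) = (\<Sum>i<d. \<Sum>j<d. v $ i * A $$ (i, j) * v $ j)"
  using assms by (simp add: scalar_prod_def atLeast0LessThan sum_distrib_left mult_ac)

lemma invertible_mat_if_positive:
  fixes A :: "real mat"
  assumes A: "A \<in> carrier_mat d d"
    and pos: "\<And>v. \<exists>i<d. v i \<noteq> 0 \<Longrightarrow> 0 < (\<Sum>i<d. \<Sum>j<d. v i * A $$ (i, j) * v j)"
  shows "invertible_mat A"
proof -
  have "Determinant.det A \<noteq> 0"
  proof (rule det_nonzero_if_positive[OF A])
    fix v :: "real vec" assume v: "v \<in> carrier_vec d" "v \<noteq> 0\<^sub>v d"
    then have "\<exists>i<d. v $ i \<noteq> 0" by (metis carrier_vecD eq_vecI index_zero_vec)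
    then show "0 < v \<bullet> (A *\<^sub>v v)" using pos scalar_prod_mult_mat_vec[OF A v(1)] by simp
  qed
  from mat_inv[OF A this] A show ?thesis
    unfolding invertible_mat_def inverts_mat_def by auto
qed

text \<open>Law of total variance: the component means add the nonnegative \<open>\<Sum> p\<^sub>i (w\<^sub>i - w)\<^sup>2\<close>.\<close>

lemma mixture_cov_positive:
  fixes p :: "nat \<Rightarrow> real" and q :: "nat \<Rightarrow> nat \<Rightarrow> nat \<Rightarrow> real" and \<mu> :: "nat \<Rightarrow> nat \<Rightarrow> real"
  assumes p: "\<And>i. i < n \<Longrightarrow> 0 \<le> p i" "(\<Sum>i<n. p i) = 1"
    and q: "\<And>i. i < n \<Longrightarrow> 0 < (\<Sum>r<d. \<Sum>c<d. v r * q i r c * v c)"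
  shows "0 < (\<Sum>r<d. \<Sum>c<d. v r * ((\<Sum>i<n. (q i r c + \<mu> i r * \<mu> i c) * p i) -
    (\<Sum>i<n. \<mu> i r * p i) * (\<Sum>i<n. \<mu> i c * p i)) * v c)" (is "0 < ?V")
proof -
  define qv where "qv i = (\<Sum>r<d. \<Sum>c<d. v r * q i r c * v c)" for i
  define w where "w i = (\<Sum>r<d. v r * \<mu> i r)" for i
  define wb where "wb = (\<Sum>i<n. p i * w i)"
  have e1: "(\<Sum>r<d. v r * (\<Sum>i<n. \<mu> i r * p i)) = wb"
    unfolding wb_def w_def sum_distrib_left by (subst sum.swap) (simp add: mult_ac)
  have e2: "(\<Sum>r<d. \<Sum>c<d. v r * (\<Sum>i<n. (q i r c + \<mu> i r * \<mu> i c) * p i) * v c) =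
      (\<Sum>i<n. p i * (qv i + w i * w i))"
  proof -
    have "(\<Sum>r<d. \<Sum>c<d. v r * (\<Sum>i<n. (q i r c + \<mu> i r * \<mu> i c) * p i) * v c) =
      (\<Sum>r<d. \<Sum>c<d. \<Sum>i<n. p i * (v r * q i r c * v c + v r * \<mu> i r * (v c * \<mu> i c)))"
      by (intro sum.cong refl) (simp add: sum_distrib_left sum_distrib_right algebra_simps)
    also have "\<dots> = (\<Sum>r<d. \<Sum>i<n. \<Sum>c<d. p i * (v r * q i r c * v c + v r * \<mu> i r * (v c * \<mu> i c)))"
      by (rule sum.cong[OF refl], rule sum.swap)
    also have "\<dots> = (\<Sum>i<n. \<Sum>r<d. \<Sum>c<d. p i * (v r * q i r c * v c + v r * \<mu> i r * (v c * \<mu> i c)))"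
      by (rule sum.swap)
    also have "\<dots> = (\<Sum>i<n. p i * (qv i + w i * w i))"
      by (intro sum.cong refl)
        (simp only: qv_def w_def sum.distrib sum_distrib_left[symmetric] sum_distrib_right[symmetric])
    finally show ?thesis .
  qed
  have "?V = (\<Sum>r<d. \<Sum>c<d. v r * (\<Sum>i<n. (q i r c + \<mu> i r * \<mu> i c) * p i) * v c) -
      (\<Sum>r<d. \<Sum>c<d. (v r * (\<Sum>i<n. \<mu> i r * p i)) * (v c * (\<Sum>i<n. \<mu> i c * p i)))"
    unfolding sum_subtractf[symmetric]
    by (intro sum.cong refl) (simp add: left_diff_distrib right_diff_distrib mult_ac)
  also have "\<dots> = (\<Sum>i<n. p i * (qv i + w i * w i)) - wb * wb"
    unfolding e2 sum_product[symmetric] e1 ..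
  \<comment> \<open>Inserting the total mass one completes the square and turns the second moment of
    \<open>w\<close> into a variance.\<close>
  also have "wb * wb = 2 * wb * wb - wb * wb * (\<Sum>i<n. p i)" by (simp add: p)
  also have "(\<Sum>i<n. p i * (qv i + w i * w i)) - \<dots> =
      (\<Sum>i<n. p i * qv i) + (\<Sum>i<n. p i * (w i - wb)\<^sup>2)"
  proof -
    have "(\<Sum>i<n. p i * (w i - wb)\<^sup>2) = (\<Sum>i<n. p i * (w i * w i)) - 2 * wb * (\<Sum>i<n. p i * w i) + wb * wb * (\<Sum>i<n. p i)"
      unfolding sum_distrib_left sum_subtractf[symmetric] sum.distrib[symmetric]
      by (intro sum.cong refl) (simp add: power2_eq_square algebra_simps)
    then show ?thesis by (simp add: wb_def[symmetric] distrib_left sum.distrib)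
  qed
  also have "\<dots> > 0"
  proof (rule add_pos_nonneg)
    \<comment> \<open>Strictness comes from a single component: weights summing to one include a
      positive one, and its quadratic form is positive at \<open>v\<close>.\<close>
    have "\<exists>i<n. p i \<noteq> 0" using p(2) by (metis lessThan_iff sum.neutral zero_neq_one)
    then obtain i where i: "i < n" "p i > 0" using p(1) by (metis order_le_less)
    have "0 < p i * qv i" using i q[OF i(1)] by (simp add: qv_def)
    also have "\<dots> \<le> (\<Sum>i<n. p i * qv i)"
      using i p(1) q by (intro member_le_sum) (auto simp: qv_def less_imp_le)
    finally show "0 < (\<Sum>i<n. p i * qv i)" .
    show "0 \<le> (\<Sum>i<n. p i * (w i - wb)\<^sup>2)" using p(1) by (intro sum_nonneg) auto
  qed
  finally show ?thesis .
qed

lemma mean_mat_carrier [simp]: "mean_mat n d m a \<in> carrier_mat (d a) n"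
  unfolding mean_mat_def by (rule carrier_matI) auto

lemma mean_mat_index [simp]: "r < d a \<Longrightarrow> i < n \<Longrightarrow> mean_mat n d m a $$ (r, i) = m a i $ r"
  by (simp add: mean_mat_def mat_of_cols_index)

lemma mean_mat_dim [simp]: "dim_row (mean_mat n d m a) = d a" "dim_col (mean_mat n d m a) = n"
  by (simp_all add: mean_mat_def)

lemma mean_mat_mult_vec:
  "mean_mat n d m a *\<^sub>v vec n p = vec (d a) (\<lambda>r. \<Sum>i<n. m a i $ r * p i)"
  by (rule eq_vecI) (simp_all add: scalar_prod_def atLeast0LessThan)

text \<open>This is diag(p) - p p^T, the covariance of a random unit vector that equals
  \<open>unit_vec n i\<close> with probability \<open>p i\<close>.\<close>

definition categorical_cov :: "nat \<Rightarrow> (nat \<Rightarrow> real) \<Rightarrow> real mat" where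
  "categorical_cov n p = mat n n (\<lambda>(i, j). (if i = j then p i else 0) - p i * p j)"

text \<open>The right-hand side is the shape in which conditioning delivers the cross covariance of
  state and observation; recognizing it as a matrix product yields the left factor of the
  gain.\<close>

lemma categorical_cov_mult_mean_mat:
  "categorical_cov n p * transpose_mat (mean_mat n d m a) =
   mat n (d a) (\<lambda>(i, c). m a i $ c * p i - p i * (\<Sum>j<n. m a j $ c * p j))"
proof (rule eq_matI)
  fix i c assume "i < dim_row (mat n (d a) (\<lambda>(i, c). m a i $ c * p i - p i * (\<Sum>j<n. m a j $ c * p j)))"
    "c < dim_col (mat n (d a) (\<lambda>(i, c). m a i $ c * p i - p i * (\<Sum>j<n. m a j $ c * p j)))"
  then have i: "i < n" and c: "c < d a" by auto
  have "(categorical_cov n p * transpose_mat (mean_mat n d m a)) $$ (i, c) =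
      (\<Sum>j<n. ((if i = j then p i else 0) - p i * p j) * m a j $ c)"
    using i c by (simp add: categorical_cov_def scalar_prod_def atLeast0LessThan)
  also have "\<dots> = (\<Sum>j<n. if i = j then p i * m a j $ c else 0) - p i * (\<Sum>j<n. m a j $ c * p j)"
    unfolding sum_distrib_left sum_subtractf[symmetric] by (intro sum.cong) (auto simp: algebra_simps)
  finally show "(categorical_cov n p * transpose_mat (mean_mat n d m a)) $$ (i, c) =
     mat n (d a) (\<lambda>(i, c). m a i $ c * p i - p i * (\<Sum>j<n. m a j $ c * p j)) $$ (i, c)"
    using i c by (simp add: mult.commute)
qed (auto simp: categorical_cov_def)

text \<open>Law of total covariance: the spread of the component means plus the averaged component
  covariances is the second moment minus the product of the means. The latter is what conditioning
  produces and what \<open>mixture_cov_positive\<close> treats.\<close>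

lemma mixture_cov_eq:
  "mean_mat n d m a * categorical_cov n p * transpose_mat (mean_mat n d m a) + mix_cov n d Q (vec n p) a =
   mat (d a) (d a) (\<lambda>(r, c). (\<Sum>i<n. (Q a i $$ (r, c) + m a i $ r * m a i $ c) * p i) -
     (\<Sum>i<n. m a i $ r * p i) * (\<Sum>i<n. m a i $ c * p i))"
proof -
  have "mean_mat n d m a * categorical_cov n p * transpose_mat (mean_mat n d m a) =
      mean_mat n d m a * (categorical_cov n p * transpose_mat (mean_mat n d m a))"
    by (rule assoc_mult_mat[of _ "d a" n _ n _ "d a"]) (auto simp: categorical_cov_def)
  also have "\<dots> = mat (d a) (d a) (\<lambda>(r, c). (\<Sum>i<n. m a i $ r * (m a i $ c * p i - p i * (\<Sum>j<n. m a j $ c * p j))))"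
    unfolding categorical_cov_mult_mean_mat
    by (rule eq_matI) (auto simp: scalar_prod_def atLeast0LessThan)
  finally show ?thesis
    by (intro eq_matI)
      (auto simp: mix_cov_def sum.distrib[symmetric] sum_distrib_right sum_subtractf[symmetric] algebra_simps)
qed

section \<open>Conditional expectations and histories\<close>

lemma (in prob_space) sigma_finite_subalgebraI:
  assumes "subalgebra M F"
  shows "sigma_finite_subalgebra M F"
proof -
  interpret finite_measure_subalgebra M F by unfold_locales (rule assms)
  show ?thesis by unfold_locales
qed

lemma integrable_mult_bounded:
  fixes a g :: "'a \<Rightarrow> real"
  assumes [measurable]: "a \<in> borel_measurable M" and g: "integrable M g"
    and bd: "AE x in M. \<bar>a x\<bar> \<le> A"
  shows "integrable M (\<lambda>x. a x * g x)"
proof (rule Bochner_Integration.integrable_bound[of M "\<lambda>x. A * g x"])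
  show "AE x in M. norm (a x * g x) \<le> norm (A * g x)"
    using bd by eventually_elim (auto simp: abs_mult intro!: mult_right_mono)
qed (use g in auto)

text \<open>The conditional means \<open>a\<close> and \<open>b\<close> are
  \<open>F\<close>-measurable and can be pulled out of each term of the expanded product. Their
  essential boundedness keeps every term integrable although \<open>f\<close> and \<open>g\<close>
  may be unbounded.\<close>

lemma (in prob_space) real_cond_exp_centered_mult:
  assumes sub: "subalgebra M F"
    and int: "integrable M f" "integrable M g" "integrable M (\<lambda>\<omega>. f \<omega> * g \<omega>)"
    and [measurable]: "a \<in> borel_measurable F" "b \<in> borel_measurable F"
    and ce: "AE \<omega> in M. real_cond_exp M F f \<omega> = a \<omega>" "AE \<omega> in M. real_cond_exp M F g \<omega> = b \<omega>"
    and bd: "AE \<omega> in M. \<bar>a \<omega>\<bar> \<le> A" "AE \<omega> in M. \<bar>b \<omega>\<bar> \<le> B"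
  shows "integrable M (\<lambda>\<omega>. (f \<omega> - a \<omega>) * (g \<omega> - b \<omega>))"
    and "AE \<omega> in M. real_cond_exp M F (\<lambda>\<omega>. (f \<omega> - a \<omega>) * (g \<omega> - b \<omega>)) \<omega> =
      real_cond_exp M F (\<lambda>\<omega>. f \<omega> * g \<omega>) \<omega> - a \<omega> * b \<omega>"
proof -
  interpret F: sigma_finite_subalgebra M F by (rule sigma_finite_subalgebraI[OF sub])
  have [measurable]: "a \<in> borel_measurable M" "b \<in> borel_measurable M"
    by (rule measurable_from_subalg[OF sub], measurable)+
  have [measurable]: "f \<in> borel_measurable M" "g \<in> borel_measurable M" using int by auto
  have "integrable M (\<lambda>\<omega>. b \<omega> * 1)" by (rule integrable_mult_bounded[OF _ _ bd(2)]) auto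
  then have b: "integrable M b" by simp
  have i: "integrable M (\<lambda>\<omega>. a \<omega> * g \<omega>)" "integrable M (\<lambda>\<omega>. b \<omega> * f \<omega>)" "integrable M (\<lambda>\<omega>. a \<omega> * b \<omega>)"
    by (rule integrable_mult_bounded[OF _ _ bd(1)] integrable_mult_bounded[OF _ _ bd(2)]; use int b in simp)+
  \<comment> \<open>The nesting is chosen so that the binary linearity rules peel off one term at a
    time.\<close>
  have eq: "(\<lambda>\<omega>. (f \<omega> - a \<omega>) * (g \<omega> - b \<omega>)) = (\<lambda>\<omega>. f \<omega> * g \<omega> - (a \<omega> * g \<omega> + (b \<omega> * f \<omega> - a \<omega> * b \<omega>)))"
    by (auto simp: algebra_simps)
  show "integrable M (\<lambda>\<omega>. (f \<omega> - a \<omega>) * (g \<omega> - b \<omega>))"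
    unfolding eq using i int by simp
  have "AE \<omega> in M. real_cond_exp M F (\<lambda>\<omega>. f \<omega> * g \<omega> - (a \<omega> * g \<omega> + (b \<omega> * f \<omega> - a \<omega> * b \<omega>))) \<omega> =
      real_cond_exp M F (\<lambda>\<omega>. f \<omega> * g \<omega>) \<omega> - real_cond_exp M F (\<lambda>\<omega>. a \<omega> * g \<omega> + (b \<omega> * f \<omega> - a \<omega> * b \<omega>)) \<omega>"
    by (rule F.real_cond_exp_diff) (use i int in simp_all)
  moreover have "AE \<omega> in M. real_cond_exp M F (\<lambda>\<omega>. a \<omega> * g \<omega> + (b \<omega> * f \<omega> - a \<omega> * b \<omega>)) \<omega> =
      real_cond_exp M F (\<lambda>\<omega>. a \<omega> * g \<omega>) \<omega> + real_cond_exp M F (\<lambda>\<omega>. b \<omega> * f \<omega> - a \<omega> * b \<omega>) \<omega>"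
    by (rule F.real_cond_exp_add) (use i int in simp_all)
  moreover have "AE \<omega> in M. real_cond_exp M F (\<lambda>\<omega>. b \<omega> * f \<omega> - a \<omega> * b \<omega>) \<omega> =
      real_cond_exp M F (\<lambda>\<omega>. b \<omega> * f \<omega>) \<omega> - real_cond_exp M F (\<lambda>\<omega>. a \<omega> * b \<omega>) \<omega>"
    by (rule F.real_cond_exp_diff) (use i int in simp_all)
  moreover have "AE \<omega> in M. real_cond_exp M F (\<lambda>\<omega>. a \<omega> * b \<omega>) \<omega> = a \<omega> * b \<omega>"
    by (rule F.real_cond_exp_F_meas) (use i in simp_all)
  moreover have "AE \<omega> in M. real_cond_exp M F (\<lambda>\<omega>. a \<omega> * g \<omega>) \<omega> = a \<omega> * real_cond_exp M F g \<omega>"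
    "AE \<omega> in M. real_cond_exp M F (\<lambda>\<omega>. b \<omega> * f \<omega>) \<omega> = b \<omega> * real_cond_exp M F f \<omega>"
    by (rule F.real_cond_exp_mult; use i in simp)+
  ultimately show "AE \<omega> in M. real_cond_exp M F (\<lambda>\<omega>. (f \<omega> - a \<omega>) * (g \<omega> - b \<omega>)) \<omega> =
      real_cond_exp M F (\<lambda>\<omega>. f \<omega> * g \<omega>) \<omega> - a \<omega> * b \<omega>"
    unfolding eq using ce by eventually_elim simp
qed

text \<open>The padded entry that \<open>vec_cond_exp\<close> conditions, made a function of the
  vector so that it is measurable across all dimensions at once.\<close>

definition coord :: "nat \<Rightarrow> real vec \<Rightarrow> real" where
  "coord i v = (if i < dim_vec v then v $ i else 0)"

lemma measurable_coord [measurable]: "coord i \<in> borel_measurable vec_borel"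
  unfolding coord_def by measurable

lemma vec_cond_exp_coord:
  "vec_cond_exp M F X \<omega> = vec (dim_vec (X \<omega>)) (\<lambda>i. real_cond_exp M F (\<lambda>\<omega>'. coord i (X \<omega>')) \<omega>)"
  by (simp add: vec_cond_exp_def coord_def)

context controlled_pomc
begin

abbreviation ctrl :: "nat \<Rightarrow> 'w \<Rightarrow> 'u" where "ctrl k \<equiv> prev_control u0 u k"
abbreviation past :: "nat \<Rightarrow> 'w measure" where "past k \<equiv> obs_history M y u (int k - 1)"
abbreviation present :: "nat \<Rightarrow> 'w measure" where "present k \<equiv> obs_history M y u (int k)"
text \<open>The conditioning of the hypothesis \<open>observation\<close>. Its controls reach
  u_{k-1}, whereas the generators of \<open>past k\<close> stop at u_{k-2}.\<close>

abbreviation joint :: "nat \<Rightarrow> 'w measure" where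
  "joint k \<equiv> history M x y u (int k) (int k - 1) (int k - 1)"

lemma space_histories [simp]:
  "space (obs_history M y u s) = space M" "space (history M x y u a b c) = space M"
  by (simp_all add: obs_history_def history_def space_measure_of_conv)

lemma sets_obs_history:
  "sets (obs_history M y u s) = sigma_sets (space M)
     ({y j -` A \<inter> space M | j A. int j \<le> s \<and> A \<in> sets vec_borel} \<union>
      {u j -` A \<inter> space M | j A. int j \<le> s - 1})"
  unfolding obs_history_def by (rule sets_measure_of) auto

lemma sets_history:
  "sets (history M x y u a b c) = sigma_sets (space M)
     ({x j -` A \<inter> space M | j A. int j \<le> a \<and> A \<in> sets vec_borel} \<union>
      {y j -` A \<inter> space M | j A. int j \<le> b \<and> A \<in> sets vec_borel} \<union>
      {u j -` A \<inter> space M | j A. int j \<le> c})"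
  unfolding history_def by (rule sets_measure_of) auto

lemma state_in: "\<omega> \<in> space M \<Longrightarrow> x k \<omega> \<in> unit_vec n ` {..<n}"
  using measurable_space[OF state_measurable] by simp

lemma state_dim: "\<omega> \<in> space M \<Longrightarrow> dim_vec (x k \<omega>) = n"
  using state_in[of \<omega> k] by auto

lemma state_vec_measurable [measurable]: "x k \<in> M \<rightarrow>\<^sub>M vec_borel"
  using measurable_compose[OF state_measurable, of "\<lambda>v. v" vec_borel k] by simp

lemma control_in: "\<omega> \<in> space M \<Longrightarrow> u k \<omega> \<in> U"
  using measurable_space[OF control_measurable] by simp

text \<open>The generators of the histories use arbitrary sets of controls, while measurability is
  given into \<open>count_space U\<close> only; intersecting with \<open>U\<close> bridges the
  gap.\<close>

lemma control_vimage: "u j -` A \<inter> space M \<in> sets M"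
proof -
  have "u j -` A \<inter> space M = u j -` (A \<inter> U) \<inter> space M" using control_in by auto
  then show ?thesis using measurable_sets[OF control_measurable, of "A \<inter> U" j] by simp
qed

lemma subalgebra_obs_history: "subalgebra M (obs_history M y u s)"
  unfolding subalgebra_def sets_obs_history space_histories
  by (intro conjI refl sets.sigma_sets_subset) (auto simp: control_vimage measurable_sets[OF obs_measurable])

lemma subalgebra_history: "subalgebra M (history M x y u a b c)"
  unfolding subalgebra_def sets_history space_histories
  by (intro conjI refl sets.sigma_sets_subset)
    (auto simp: control_vimage measurable_sets[OF obs_measurable] measurable_sets[OF state_vec_measurable])

lemma subalgebra_obs_obs:
  assumes "s \<le> t"
  shows "subalgebra (obs_history M y u t) (obs_history M y u s)"
proof -
  have obs: "{y j -` A \<inter> space M | j A. int j \<le> s \<and> A \<in> sets vec_borel} \<subseteq>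
      {y j -` A \<inter> space M | j A. int j \<le> t \<and> A \<in> sets vec_borel}"
    using assms by (intro Collect_mono ex_mono impI allI) auto
  have control: "{u j -` A \<inter> space M | j A. int j \<le> s - 1} \<subseteq> {u j -` A \<inter> space M | j A. int j \<le> t - 1}"
    using assms by (intro Collect_mono ex_mono impI allI) auto
  show ?thesis
    unfolding subalgebra_def sets_obs_history space_histories
    by (intro conjI refl sigma_sets_mono' Un_mono[OF obs control])
qed

lemma subalgebra_history_obs:
  assumes "s \<le> b" "s - 1 \<le> c"
  shows "subalgebra (history M x y u a b c) (obs_history M y u s)"
proof -
  have obs: "{y j -` A \<inter> space M | j A. int j \<le> s \<and> A \<in> sets vec_borel} \<subseteq>
      {y j -` A \<inter> space M | j A. int j \<le> b \<and> A \<in> sets vec_borel}"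
    using assms by (intro Collect_mono ex_mono impI allI) auto
  have control: "{u j -` A \<inter> space M | j A. int j \<le> s - 1} \<subseteq> {u j -` A \<inter> space M | j A. int j \<le> c}"
    using assms by (intro Collect_mono ex_mono impI allI) auto
  show ?thesis
    unfolding subalgebra_def sets_history sets_obs_history space_histories
    by (intro conjI refl sigma_sets_mono' Un_mono[OF le_supI2[OF obs] control])
qed

lemmas obs_history_sigma_finite = sigma_finite_subalgebraI[OF subalgebra_obs_history]
lemmas history_sigma_finite = sigma_finite_subalgebraI[OF subalgebra_history]

lemma obs_measurable_obs_history: "int j \<le> s \<Longrightarrow> y j \<in> obs_history M y u s \<rightarrow>\<^sub>M vec_borel"
  by (rule measurableI) (auto simp: sets_obs_history intro!: sigma_sets.Basic)

lemma control_measurable_obs_history: "int j \<le> s - 1 \<Longrightarrow> u j \<in> obs_history M y u s \<rightarrow>\<^sub>M count_space U"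
proof (rule measurableI)
  fix A assume "int j \<le> s - 1"
  then show "u j -` A \<inter> space (obs_history M y u s) \<in> sets (obs_history M y u s)"
    unfolding sets_obs_history space_histories by (intro sigma_sets.Basic UnI2) blast
qed (auto simp: control_in)

lemma state_measurable_history: "int j \<le> a \<Longrightarrow> x j \<in> history M x y u a b c \<rightarrow>\<^sub>M vec_borel"
  by (rule measurableI) (auto simp: sets_history intro!: sigma_sets.Basic)

text \<open>\<open>u\<^bsub>k-1\<^esub>\<close> is not a generator of \<open>\<F>\<^bsub>k-1\<^esub>\<close>; it enters through the policy.\<close>

lemma ctrl_measurable_past: "ctrl k \<in> past k \<rightarrow>\<^sub>M count_space U"
proof (cases k)
  case 0
  have "ctrl 0 = (\<lambda>_. u0)" by (rule ext) (simp add: prev_control_def)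
  then show ?thesis using u0_in 0 by simp
next
  case (Suc j)
  have "(\<lambda>\<omega>. \<lambda>l\<in>{..j}. y l \<omega>) \<in> past k \<rightarrow>\<^sub>M (\<Pi>\<^sub>M l\<in>{..j}. vec_borel)"
    by (rule measurable_restrict, rule obs_measurable_obs_history) (simp add: Suc)
  moreover have "(\<lambda>\<omega>. \<lambda>l\<in>{..<j}. u l \<omega>) \<in> past k \<rightarrow>\<^sub>M (\<Pi>\<^sub>M l\<in>{..<j}. count_space U)"
    by (rule measurable_restrict, rule control_measurable_obs_history) (simp add: Suc)
  ultimately have meas: "(\<lambda>\<omega>. \<eta> j ((\<lambda>l\<in>{..j}. y l \<omega>), (\<lambda>l\<in>{..<j}. u l \<omega>))) \<in> past k \<rightarrow>\<^sub>M count_space U"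
    by (rule measurable_compose[OF measurable_Pair policy_measurable])
  have eq: "\<eta> j ((\<lambda>l\<in>{..j}. y l \<omega>), (\<lambda>l\<in>{..<j}. u l \<omega>)) = ctrl k \<omega>" if "\<omega> \<in> space (past k)" for \<omega>
    unfolding Suc prev_control_def nat.case using that
    by (intro control_policy[symmetric]) simp
  show ?thesis by (rule measurable_cong[THEN iffD1, OF eq meas])
qed

lemma ctrl_measurable [measurable]: "ctrl k \<in> M \<rightarrow>\<^sub>M count_space U"
  by (rule measurable_from_subalg[OF subalgebra_obs_history ctrl_measurable_past])

lemma ctrl_in: "\<omega> \<in> space M \<Longrightarrow> ctrl k \<omega> \<in> U"
  using measurable_space[OF ctrl_measurable] by simp

lemma fun_ctrl_measurable_past: "(\<lambda>\<omega>. \<gamma> (ctrl k \<omega>) :: real) \<in> borel_measurable (past k)"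
  by (rule measurable_compose[OF ctrl_measurable_past]) simp

lemma obs_dim': "\<omega> \<in> space M \<Longrightarrow> dim_vec (y k \<omega>) = d (ctrl k \<omega>)"
  using obs_dim by auto

text \<open>Coordinates of the state are indicators, so conditioning them gives conditional
  probabilities, and multiplying by them localizes to one state.\<close>

lemma coord_state: "\<omega> \<in> space M \<Longrightarrow> i < n \<Longrightarrow> coord i (x k \<omega>) = (if x k \<omega> = unit_vec n i then 1 else 0)"
  using state_in[of \<omega> k] by (auto simp: coord_def)

lemma coord_state_bound: "\<omega> \<in> space M \<Longrightarrow> \<bar>coord i (x k \<omega>)\<bar> \<le> 1"
  using state_in[of \<omega> k] by (auto simp: coord_def)

lemma coord_state_sum: "\<omega> \<in> space M \<Longrightarrow> (\<Sum>i<n. coord i (x k \<omega>)) = 1"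
  using state_in[of \<omega> k] by (auto simp: coord_def)

lemma coord_state_integrable [simp]: "integrable M (\<lambda>\<omega>. coord i (x k \<omega>))"
  by (rule integrable_const_bound[of _ 1]) (auto simp: coord_state_bound)

end

section \<open>Conditional law of the observation\<close>

lemma singleton_vec_borel [measurable]: "{v} \<in> sets vec_borel"
proof -
  have "{v} = {w. dim_vec w = dim_vec v \<and> (\<forall>i<dim_vec v. w $ i \<in> {v $ i})}" by auto
  also have "\<dots> \<in> sets vec_borel" by (rule sets_vec_borel_box) auto
  finally show ?thesis .
qed

lemma sets_gauss_law [simp, measurable_cong]: "sets (gauss_law \<mu> A) = sets vec_borel"
  by (simp add: gauss_law_def vec_lborel_def)

lemma space_gauss_law [simp]: "space (gauss_law \<mu> A) = UNIV"
  by (simp add: gauss_law_def vec_lborel_def)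

lemma prob_space_gauss_law:
  assumes "\<mu> \<in> carrier_vec e" "pos_def_mat e A"
  shows "prob_space (gauss_law \<mu> A)"
proof
  have "measure (gauss_law \<mu> A) UNIV = 1"
    using has_bochner_integral_integral_eq[OF gauss_law_moments(1)[OF assms]] by simp
  \<comment> \<open>\<open>measure\<close> returns zero for infinite mass, so the value one excludes
    that case.\<close>
  then show "emeasure (gauss_law \<mu> A) (space (gauss_law \<mu> A)) = 1"
    by (metis emeasure_eq_ennreal_measure ennreal_1 measure_zero_top space_gauss_law zero_neq_one)
qed

context controlled_pomc
begin

abbreviation law :: "'u \<Rightarrow> nat \<Rightarrow> real vec measure" where "law a i \<equiv> gauss_law (m a i) (Q a i)"

text \<open>On such a set the law in \<open>observation\<close> is the single measure
  \<open>law a i\<close>, free of randomness.\<close>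

definition event :: "nat \<Rightarrow> nat \<Rightarrow> 'u \<Rightarrow> 'w set" where
  "event k i a = {\<omega> \<in> space M. x k \<omega> = unit_vec n i \<and> ctrl k \<omega> = a}"

lemma ctrl_measurable_joint: "ctrl k \<in> joint k \<rightarrow>\<^sub>M count_space U"
  by (rule measurable_from_subalg[OF subalgebra_history_obs ctrl_measurable_past]) auto

lemma event_joint: "a \<in> U \<Longrightarrow> event k i a \<in> sets (joint k)"
proof -
  assume "a \<in> U"
  have "event k i a = (x k -` {unit_vec n i} \<inter> space (joint k)) \<inter> (ctrl k -` {a} \<inter> space (joint k))"
    by (auto simp: event_def)
  also have "\<dots> \<in> sets (joint k)"
    by (rule sets.Int[OF measurable_sets[OF state_measurable_history singleton_vec_borel]
          measurable_sets[OF ctrl_measurable_joint]]) (use \<open>a \<in> U\<close> in auto)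
  finally show ?thesis .
qed

lemma sets_joint_M: "B \<in> sets (joint k) \<Longrightarrow> B \<in> sets M"
  using subalgebra_history by (auto simp: subalgebra_def)

text \<open>Integrated form of \<open>observation\<close>: over \<open>B\<close> intersected with
  the event, the conditional probability of \<open>A\<close> is a constant.\<close>

lemma prob_obs:
  assumes B: "B \<in> sets (joint k)" and a: "a \<in> U" and i: "i < n" and A: "A \<in> sets vec_borel"
  shows "prob (B \<inter> event k i a \<inter> (y k -` A \<inter> space M)) = prob (B \<inter> event k i a) * measure (law a i) A"
proof -
  interpret H: sigma_finite_subalgebra M "joint k" by (rule history_sigma_finite)
  let ?E = "B \<inter> event k i a"
  have E: "?E \<in> sets (joint k)" using B event_joint[OF a] by auto
  note [measurable] = sets_joint_M[OF E] A
  have int: "integrable M (\<lambda>\<omega>. indicat_real A (y k \<omega>))"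
    by (rule integrable_const_bound[of _ 1]) (use obs_measurable in auto)
  have "prob (?E \<inter> (y k -` A \<inter> space M)) = (\<integral>\<omega>. indicat_real (?E \<inter> (y k -` A \<inter> space M)) \<omega> \<partial>M)"
    using measurable_sets[OF obs_measurable A] by simp
  also have "\<dots> = (\<integral>\<omega>\<in>?E. indicat_real A (y k \<omega>) \<partial>M)"
    unfolding set_lebesgue_integral_def
    by (intro Bochner_Integration.integral_cong) (auto split: split_indicator)
  also have "\<dots> = (\<integral>\<omega>\<in>?E. real_cond_exp M (joint k) (\<lambda>\<omega>. indicat_real A (y k \<omega>)) \<omega> \<partial>M)"
    by (rule H.real_cond_exp_intA[OF int E])
  also have "\<dots> = (\<integral>\<omega>. indicat_real ?E \<omega> * measure (law a i) A \<partial>M)"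
    unfolding set_lebesgue_integral_def
  proof (rule integral_cong_AE)
    show "AE \<omega> in M. indicat_real ?E \<omega> *\<^sub>R real_cond_exp M (joint k) (\<lambda>\<omega>. indicat_real A (y k \<omega>)) \<omega> =
       indicat_real ?E \<omega> * measure (law a i) A"
      using observation[OF i A, of k] by eventually_elim (auto simp: event_def split: split_indicator)
  qed measurable
  also have "\<dots> = prob ?E * measure (law a i) A" by simp
  finally show ?thesis .
qed

text \<open>By \<open>prob_obs\<close> the image under \<open>y k\<close> of the probability
  restricted to the event is a multiple of the Gaussian law. Equality of measures replaces an
  approximation of \<open>g\<close> by simple functions.\<close>

lemma has_bochner_integral_obs:
  assumes B: "B \<in> sets (joint k)" and a: "a \<in> U" and i: "i < n"
    and g [measurable]: "g \<in> borel_measurable vec_borel"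
    and int: "has_bochner_integral (law a i) g (\<gamma> :: real)"
  shows "has_bochner_integral M (\<lambda>\<omega>. indicat_real (B \<inter> event k i a) \<omega> * g (y k \<omega>)) (prob (B \<inter> event k i a) * \<gamma>)"
proof -
  let ?E = "B \<inter> event k i a"
  interpret L: prob_space "law a i"
    by (rule prob_space_gauss_law[OF mean_carrier[OF a i] cov_pos_def[OF a i]])
  have E [measurable]: "?E \<in> sets M" using B event_joint[OF a] by (intro sets_joint_M[of _ k]) auto
  note obs_measurable [measurable]
  have eq: "distr (density M (\<lambda>\<omega>. ennreal (indicat_real ?E \<omega>))) vec_borel (y k) = density (law a i) (\<lambda>_. ennreal (prob ?E))"
  proof (rule measure_eqI)
    fix A assume "A \<in> sets (distr (density M (\<lambda>\<omega>. ennreal (indicat_real ?E \<omega>))) vec_borel (y k))"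
    then have A [measurable]: "A \<in> sets vec_borel" by simp
    have YA: "y k -` A \<inter> space M \<in> sets M" by measurable
    have "emeasure (distr (density M (\<lambda>\<omega>. ennreal (indicat_real ?E \<omega>))) vec_borel (y k)) A =
        emeasure (density M (\<lambda>\<omega>. ennreal (indicat_real ?E \<omega>))) (y k -` A \<inter> space M)"
      by (subst emeasure_distr) auto
    also have "\<dots> = (\<integral>\<^sup>+\<omega>. ennreal (indicat_real ?E \<omega>) * indicator (y k -` A \<inter> space M) \<omega> \<partial>M)"
      by (rule emeasure_density) (use YA in auto)
    also have "\<dots> = (\<integral>\<^sup>+\<omega>. indicator (?E \<inter> (y k -` A \<inter> space M)) \<omega> \<partial>M)"
      by (intro nn_integral_cong) (auto split: split_indicator)
    also have "\<dots> = ennreal (prob (?E \<inter> (y k -` A \<inter> space M)))"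
      using E YA by (subst nn_integral_indicator) (auto simp: emeasure_eq_measure)
    also have "\<dots> = ennreal (prob ?E) * emeasure (law a i) A"
      unfolding prob_obs[OF B a i A] by (simp add: ennreal_mult L.emeasure_eq_measure)
    also have "\<dots> = emeasure (density (law a i) (\<lambda>_. ennreal (prob ?E))) A"
      by (subst emeasure_density) (auto simp: nn_integral_cmult)
    finally show "emeasure (distr (density M (\<lambda>\<omega>. ennreal (indicat_real ?E \<omega>))) vec_borel (y k)) A = \<dots>" .
  qed simp
  have "has_bochner_integral (density (law a i) (\<lambda>_. ennreal (prob ?E))) g (prob ?E * \<gamma>)"
    by (rule has_bochner_integral_density) (use has_bochner_integral_mult_right[OF int] in auto)
  then have "has_bochner_integral (density M (\<lambda>\<omega>. ennreal (indicat_real ?E \<omega>))) (\<lambda>\<omega>. g (y k \<omega>)) (prob ?E * \<gamma>)"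
    unfolding eq[symmetric] has_bochner_integral_iff
    by (subst (asm) integrable_distr_eq, simp, simp, subst (asm) integral_distr) auto
  then show ?thesis
    unfolding has_bochner_integral_iff
    by (subst (asm) integrable_density, simp, simp, simp, subst (asm) integral_density) auto
qed

definition pred :: "nat \<Rightarrow> nat \<Rightarrow> 'w \<Rightarrow> real" where
  "pred k i = real_cond_exp M (past k) (\<lambda>\<omega>. coord i (x k \<omega>))"

text \<open>If the state is e_i, exactly one control value contributes, otherwise none. This splits
  a function of the random control into finitely many terms with frozen control.\<close>

lemma sum_event:
  assumes "\<omega> \<in> space M" "i < n"
  shows "(\<Sum>a\<in>U. indicat_real (event k i a) \<omega> * f a) = coord i (x k \<omega>) * f (ctrl k \<omega>)"
proof -
  have "(\<Sum>a\<in>U. indicat_real (event k i a) \<omega> * f a) =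
      (\<Sum>a\<in>U. if a = ctrl k \<omega> then coord i (x k \<omega>) * f a else 0)"
    using assms by (intro sum.cong refl) (auto simp: event_def coord_state indicator_def)
  also have "\<dots> = coord i (x k \<omega>) * f (ctrl k \<omega>)"
    using finite_controls ctrl_in[OF assms(1)] by simp
  finally show ?thesis .
qed

text \<open>Two-stage conditioning, first on \<open>joint k\<close>, where the observation law is
  known, then on \<open>past k\<close>. The integrand \<open>g\<close> may vary with the control
  because the dimension of the observation does.\<close>

lemma cond_exp_obs:
  assumes i: "i < n"
    and g: "\<And>a. a \<in> U \<Longrightarrow> g a \<in> borel_measurable vec_borel"
    and int: "\<And>a. a \<in> U \<Longrightarrow> has_bochner_integral (law a i) (g a) (\<gamma> a :: real)"
  shows "integrable M (\<lambda>\<omega>. coord i (x k \<omega>) * g (ctrl k \<omega>) (y k \<omega>))"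
    and "AE \<omega> in M. real_cond_exp M (past k) (\<lambda>\<omega>. coord i (x k \<omega>) * g (ctrl k \<omega>) (y k \<omega>)) \<omega> =
      \<gamma> (ctrl k \<omega>) * pred k i \<omega>"
proof -
  interpret H: sigma_finite_subalgebra M "joint k" by (rule history_sigma_finite)
  interpret F: sigma_finite_subalgebra M "past k" by (rule obs_history_sigma_finite)
  let ?f = "\<lambda>\<omega>. coord i (x k \<omega>) * g (ctrl k \<omega>) (y k \<omega>)"
  let ?h = "\<lambda>\<omega>. \<gamma> (ctrl k \<omega>) * coord i (x k \<omega>)"
  have ev: "event k i a \<in> sets (joint k)" if "a \<in> U" for a using event_joint[OF that] .
  have f_eq: "?f \<omega> = (\<Sum>a\<in>U. indicat_real (event k i a) \<omega> * g a (y k \<omega>))" if "\<omega> \<in> space M" for \<omega>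
    using sum_event[OF that i, of k "\<lambda>a. g a (y k \<omega>)"] by simp
  have fB: "has_bochner_integral M (\<lambda>\<omega>. indicat_real B \<omega> * ?f \<omega>) (\<Sum>a\<in>U. prob (B \<inter> event k i a) * \<gamma> a)"
    if B: "B \<in> sets (joint k)" for B
  proof -
    have "has_bochner_integral M (\<lambda>\<omega>. \<Sum>a\<in>U. indicat_real (B \<inter> event k i a) \<omega> * g a (y k \<omega>))
        (\<Sum>a\<in>U. prob (B \<inter> event k i a) * \<gamma> a)"
      by (intro has_bochner_integral_sum has_bochner_integral_obs B i g int)
    then show ?thesis
      by (rule has_bochner_integral_cong[THEN iffD1, rotated -1])
        (auto simp: f_eq sum_distrib_left indicator_inter_arith mult_ac)
  qed
  \<comment> \<open>The same value as in \<open>fB\<close>, for every \<open>B\<close> in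
    \<open>joint k\<close>; this characterizes \<open>?h\<close> as the conditional expectation of
    \<open>?f\<close>.\<close>
  have hB: "has_bochner_integral M (\<lambda>\<omega>. indicat_real B \<omega> * ?h \<omega>) (\<Sum>a\<in>U. prob (B \<inter> event k i a) * \<gamma> a)"
    if B: "B \<in> sets (joint k)" for B
  proof -
    have "has_bochner_integral M (\<lambda>\<omega>. \<Sum>a\<in>U. indicat_real (B \<inter> event k i a) \<omega> * \<gamma> a)
        (\<Sum>a\<in>U. prob (B \<inter> event k i a) * \<gamma> a)"
      using B ev by (intro has_bochner_integral_sum has_bochner_integral_mult_left has_bochner_integral_real_indicator
          sets_joint_M[of _ k]) (auto simp: less_top[symmetric])
    moreover have "(\<Sum>a\<in>U. indicat_real (B \<inter> event k i a) \<omega> * \<gamma> a) = indicat_real B \<omega> * ?h \<omega>"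
      if "\<omega> \<in> space M" for \<omega>
      using sum_event[OF that i, of k "\<lambda>a. indicat_real B \<omega> * \<gamma> a"]
      by (simp add: indicator_inter_arith mult_ac)
    ultimately show ?thesis
      by (simp cong: has_bochner_integral_cong)
  qed
  have top: "space M \<in> sets (joint k)" using sets.top[of "joint k"] by simp
  have f_int: "integrable M ?f"
    using fB[OF top] by (subst Bochner_Integration.integrable_cong[OF refl, of M _ "\<lambda>\<omega>. indicat_real (space M) \<omega> * ?f \<omega>"])
      (auto simp: has_bochner_integral_iff)
  then show "integrable M ?f" .
  have h_int: "integrable M ?h"
    using hB[OF top] by (subst Bochner_Integration.integrable_cong[OF refl, of M _ "\<lambda>\<omega>. indicat_real (space M) \<omega> * ?h \<omega>"])
      (auto simp: has_bochner_integral_iff)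
  have c_meas: "(\<lambda>\<omega>. coord i (x k \<omega>)) \<in> borel_measurable (joint k)"
    by (rule measurable_compose[OF state_measurable_history]) auto
  have h_meas: "?h \<in> borel_measurable (joint k)"
    by (intro borel_measurable_times c_meas measurable_compose[OF ctrl_measurable_joint]) auto
  have "AE \<omega> in M. real_cond_exp M (joint k) ?f \<omega> = ?h \<omega>"
  proof (rule H.real_cond_exp_charact)
    fix B assume B: "B \<in> sets (joint k)"
    show "(\<integral>\<omega>\<in>B. ?f \<omega> \<partial>M) = (\<integral>\<omega>\<in>B. ?h \<omega> \<partial>M)"
      using fB[OF B] hB[OF B] by (simp add: set_lebesgue_integral_def has_bochner_integral_iff)
  qed (use f_int h_int h_meas in auto)
  \<comment> \<open>Descent to \<open>past k\<close>, where the factor depending on the control is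
    measurable and can be pulled out.\<close>
  then have "AE \<omega> in M. real_cond_exp M (past k) (real_cond_exp M (joint k) ?f) \<omega> = real_cond_exp M (past k) ?h \<omega>"
    by (rule F.real_cond_exp_cong) (use h_int in auto)
  moreover have "AE \<omega> in M. real_cond_exp M (past k) (real_cond_exp M (joint k) ?f) \<omega> = real_cond_exp M (past k) ?f \<omega>"
    by (rule F.real_cond_exp_nested_subalg[OF subalgebra_history subalgebra_history_obs f_int]) auto
  moreover have "AE \<omega> in M. real_cond_exp M (past k) ?h \<omega> = \<gamma> (ctrl k \<omega>) * real_cond_exp M (past k) (\<lambda>\<omega>. coord i (x k \<omega>)) \<omega>"
    by (rule F.real_cond_exp_mult) (use h_int fun_ctrl_measurable_past in auto)
  ultimately show "AE \<omega> in M. real_cond_exp M (past k) ?f \<omega> = \<gamma> (ctrl k \<omega>) * pred k i \<omega>"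
    by eventually_elim (simp add: pred_def)
qed

end

section \<open>Prediction, innovation and cross covariances\<close>

context controlled_pomc
begin

text \<open>Agreement on \<open>space M\<close> transfers measurability from \<open>g\<close> to
  \<open>f\<close>, so padded entries can be rewritten without a separate measurability
  proof.\<close>

lemma cond_exp_cong_space:
  assumes "\<And>\<omega>. \<omega> \<in> space M \<Longrightarrow> f \<omega> = g \<omega>" "g \<in> borel_measurable M" "subalgebra M F"
  shows "AE \<omega> in M. real_cond_exp M F f \<omega> = real_cond_exp M F g \<omega>"
proof -
  interpret F: sigma_finite_subalgebra M F by (rule sigma_finite_subalgebraI[OF assms(3)])
  have "f \<in> borel_measurable M" using assms(1,2) measurable_cong[of M f g borel] by blast
  then show ?thesis using assms by (intro F.real_cond_exp_cong) auto
qed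

lemma pred_measurable_past: "pred k i \<in> borel_measurable (past k)"
  unfolding pred_def by (rule borel_measurable_cond_exp)

lemma pred_nonneg: "AE \<omega> in M. 0 \<le> pred k i \<omega>"
proof -
  interpret F: sigma_finite_subalgebra M "past k" by (rule obs_history_sigma_finite)
  show ?thesis unfolding pred_def
    by (rule F.real_cond_exp_pos) (auto simp: coord_def dest!: state_in[of _ k])
qed

lemma pred_sum: "AE \<omega> in M. (\<Sum>i<n. pred k i \<omega>) = 1"
proof -
  interpret F: sigma_finite_subalgebra M "past k" by (rule obs_history_sigma_finite)
  have "AE \<omega> in M. real_cond_exp M (past k) (\<lambda>\<omega>. \<Sum>i<n. coord i (x k \<omega>)) \<omega> = (\<Sum>i<n. pred k i \<omega>)"
    unfolding pred_def by (rule F.real_cond_exp_sum) simp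
  moreover have "AE \<omega> in M. real_cond_exp M (past k) (\<lambda>\<omega>. \<Sum>i<n. coord i (x k \<omega>)) \<omega> = real_cond_exp M (past k) (\<lambda>\<omega>. 1) \<omega>"
    by (rule cond_exp_cong_space[OF coord_state_sum _ subalgebra_obs_history]) auto
  moreover have "AE \<omega> in M. real_cond_exp M (past k) (\<lambda>\<omega>. 1) \<omega> = 1"
    by (rule F.real_cond_exp_F_meas) auto
  ultimately show ?thesis by eventually_elim simp
qed

lemma pred_bound:
  assumes "i < n"
  shows "AE \<omega> in M. \<bar>pred k i \<omega>\<bar> \<le> 1"
proof -
  have "AE \<omega> in M. \<forall>j. 0 \<le> pred k j \<omega>" using pred_nonneg by (simp add: AE_all_countable)
  with pred_sum[of k] show ?thesis
  proof eventually_elim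
    case (elim \<omega>)
    have "pred k i \<omega> \<le> (\<Sum>j<n. pred k j \<omega>)"
      using assms elim by (intro member_le_sum) auto
    then show ?case using elim by simp
  qed
qed

text \<open>The coordinates of the state sum to one, so \<open>\<phi>\<close> splits into its parts
  on the individual states.\<close>

lemma cond_exp_state_sum:
  assumes [measurable]: "\<phi> \<in> borel_measurable M"
    and int: "\<And>i. i < n \<Longrightarrow> integrable M (\<lambda>\<omega>. coord i (x k \<omega>) * \<phi> \<omega>)"
    and ce: "\<And>i. i < n \<Longrightarrow> AE \<omega> in M. real_cond_exp M (past k) (\<lambda>\<omega>. coord i (x k \<omega>) * \<phi> \<omega>) \<omega> = R i \<omega>"
  shows "integrable M \<phi>" and "AE \<omega> in M. real_cond_exp M (past k) \<phi> \<omega> = (\<Sum>i<n. R i \<omega>)"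
proof -
  interpret F: sigma_finite_subalgebra M "past k" by (rule obs_history_sigma_finite)
  \<comment> \<open>Set to zero beyond \<open>n\<close>, so that the sum rule receives a family
    integrable at every index.\<close>
  define f where "f i = (\<lambda>\<omega>. if i < n then coord i (x k \<omega>) * \<phi> \<omega> else 0)" for i
  have f: "integrable M (f i)" for i using int[of i] by (cases "i < n") (simp_all add: f_def)
  have eq: "\<phi> \<omega> = (\<Sum>i<n. f i \<omega>)" if "\<omega> \<in> space M" for \<omega>
    using coord_state_sum[OF that, of k] by (simp add: f_def flip: sum_distrib_right)
  show "integrable M \<phi>"
    using f by (subst Bochner_Integration.integrable_cong[OF refl eq]) auto
  have "AE \<omega> in M. \<forall>i\<in>{..<n}. real_cond_exp M (past k) (f i) \<omega> = R i \<omega>"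
    using ce by (intro AE_finite_allI) (auto simp: f_def)
  moreover have "AE \<omega> in M. real_cond_exp M (past k) (\<lambda>\<omega>. \<Sum>i<n. f i \<omega>) \<omega> = (\<Sum>i<n. real_cond_exp M (past k) (f i) \<omega>)"
    by (rule F.real_cond_exp_sum[OF f])
  moreover have "AE \<omega> in M. real_cond_exp M (past k) \<phi> \<omega> = real_cond_exp M (past k) (\<lambda>\<omega>. \<Sum>i<n. f i \<omega>) \<omega>"
    by (rule cond_exp_cong_space[OF eq _ subalgebra_obs_history]) (use f in auto)
  ultimately show "AE \<omega> in M. real_cond_exp M (past k) \<phi> \<omega> = (\<Sum>i<n. R i \<omega>)"
    by eventually_elim simp
qed

text \<open>Padded by zero like \<open>coord\<close>, so that the moment identities hold at every
  index whatever the current dimension; \<open>second\<close> follows the same convention.\<close>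

definition mean :: "'u \<Rightarrow> nat \<Rightarrow> nat \<Rightarrow> real" where
  "mean a i r = (if r < d a then m a i $ r else 0)"

definition second :: "'u \<Rightarrow> nat \<Rightarrow> nat \<Rightarrow> nat \<Rightarrow> real" where
  "second a i r c = (if r < d a \<and> c < d a then Q a i $$ (r, c) + m a i $ r * m a i $ c else 0)"

definition mix_mean :: "nat \<Rightarrow> nat \<Rightarrow> 'w \<Rightarrow> real" where
  "mix_mean k r \<omega> = (\<Sum>i<n. mean (ctrl k \<omega>) i r * pred k i \<omega>)"

lemma coord_obs: "\<omega> \<in> space M \<Longrightarrow> coord r (y k \<omega>) = (if r < d (ctrl k \<omega>) then y k \<omega> $ r else 0)"
  by (simp add: coord_def obs_dim')

lemma coord_obs_measurable [measurable]: "(\<lambda>\<omega>. coord r (y k \<omega>)) \<in> borel_measurable M"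
  by (rule measurable_compose[OF obs_measurable]) measurable

lemma cond_exp_state_obs:
  assumes i: "i < n"
  shows "integrable M (\<lambda>\<omega>. coord i (x k \<omega>) * coord r (y k \<omega>))"
    and "AE \<omega> in M. real_cond_exp M (past k) (\<lambda>\<omega>. coord i (x k \<omega>) * coord r (y k \<omega>)) \<omega> =
      mean (ctrl k \<omega>) i r * pred k i \<omega>"
proof -
  \<comment> \<open>Truncation at \<open>d a\<close> instead of the length of \<open>z\<close>
    leaves a plain entry or zero for each fixed control, to which the Gaussian moments apply. Along
    \<open>y k\<close> both truncations agree.\<close>
  let ?g = "\<lambda>a z. if r < d a then z $ r else (0::real)"
  have eq: "coord i (x k \<omega>) * coord r (y k \<omega>) = coord i (x k \<omega>) * ?g (ctrl k \<omega>) (y k \<omega>)" if "\<omega> \<in> space M" for \<omega>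
    using that by (simp add: coord_obs)
  have b: "has_bochner_integral (law a i) (?g a) (mean a i r)" if "a \<in> U" for a
    using gauss_law_moments(2)[OF mean_carrier[OF that i] cov_pos_def[OF that i]]
    by (auto simp: mean_def)
  have gm: "?g a \<in> borel_measurable vec_borel" for a by measurable
  have int: "integrable M (\<lambda>\<omega>. coord i (x k \<omega>) * ?g (ctrl k \<omega>) (y k \<omega>))"
    by (rule cond_exp_obs(1)[OF i, where g = ?g, OF gm b])
  have ae: "AE \<omega> in M. real_cond_exp M (past k) (\<lambda>\<omega>. coord i (x k \<omega>) * ?g (ctrl k \<omega>) (y k \<omega>)) \<omega> =
      mean (ctrl k \<omega>) i r * pred k i \<omega>"
    by (rule cond_exp_obs(2)[OF i, where g = ?g, OF gm b])
  have ae': "AE \<omega> in M. real_cond_exp M (past k) (\<lambda>\<omega>. coord i (x k \<omega>) * coord r (y k \<omega>)) \<omega> =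
      real_cond_exp M (past k) (\<lambda>\<omega>. coord i (x k \<omega>) * ?g (ctrl k \<omega>) (y k \<omega>)) \<omega>"
    by (rule cond_exp_cong_space[OF eq borel_measurable_integrable[OF int] subalgebra_obs_history])
  show "integrable M (\<lambda>\<omega>. coord i (x k \<omega>) * coord r (y k \<omega>))"
    by (subst Bochner_Integration.integrable_cong[OF refl eq]) (use int in auto)
  show "AE \<omega> in M. real_cond_exp M (past k) (\<lambda>\<omega>. coord i (x k \<omega>) * coord r (y k \<omega>)) \<omega> =
      mean (ctrl k \<omega>) i r * pred k i \<omega>"
    using ae' ae by eventually_elim simp
qed

lemma cond_exp_state_obs_obs:
  assumes i: "i < n"
  shows "integrable M (\<lambda>\<omega>. coord i (x k \<omega>) * (coord r (y k \<omega>) * coord c (y k \<omega>)))"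
    and "AE \<omega> in M. real_cond_exp M (past k) (\<lambda>\<omega>. coord i (x k \<omega>) * (coord r (y k \<omega>) * coord c (y k \<omega>))) \<omega> =
      second (ctrl k \<omega>) i r c * pred k i \<omega>"
proof -
  let ?g = "\<lambda>a z. if r < d a \<and> c < d a then z $ r * z $ c else (0::real)"
  have eq: "coord i (x k \<omega>) * (coord r (y k \<omega>) * coord c (y k \<omega>)) = coord i (x k \<omega>) * ?g (ctrl k \<omega>) (y k \<omega>)"
    if "\<omega> \<in> space M" for \<omega> using that by (simp add: coord_obs)
  have b: "has_bochner_integral (law a i) (?g a) (second a i r c)" if "a \<in> U" for a
    using gauss_law_moments(3)[OF mean_carrier[OF that i] cov_pos_def[OF that i]]
    by (auto simp: second_def)
  have gm: "?g a \<in> borel_measurable vec_borel" for a by measurable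
  have int: "integrable M (\<lambda>\<omega>. coord i (x k \<omega>) * ?g (ctrl k \<omega>) (y k \<omega>))"
    by (rule cond_exp_obs(1)[OF i, where g = ?g, OF gm b])
  have ae: "AE \<omega> in M. real_cond_exp M (past k) (\<lambda>\<omega>. coord i (x k \<omega>) * ?g (ctrl k \<omega>) (y k \<omega>)) \<omega> =
      second (ctrl k \<omega>) i r c * pred k i \<omega>"
    by (rule cond_exp_obs(2)[OF i, where g = ?g, OF gm b])
  have ae': "AE \<omega> in M. real_cond_exp M (past k) (\<lambda>\<omega>. coord i (x k \<omega>) * (coord r (y k \<omega>) * coord c (y k \<omega>))) \<omega> =
      real_cond_exp M (past k) (\<lambda>\<omega>. coord i (x k \<omega>) * ?g (ctrl k \<omega>) (y k \<omega>)) \<omega>"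
    by (rule cond_exp_cong_space[OF eq borel_measurable_integrable[OF int] subalgebra_obs_history])
  show "integrable M (\<lambda>\<omega>. coord i (x k \<omega>) * (coord r (y k \<omega>) * coord c (y k \<omega>)))"
    by (subst Bochner_Integration.integrable_cong[OF refl eq]) (use int in auto)
  show "AE \<omega> in M. real_cond_exp M (past k) (\<lambda>\<omega>. coord i (x k \<omega>) * (coord r (y k \<omega>) * coord c (y k \<omega>))) \<omega> =
      second (ctrl k \<omega>) i r c * pred k i \<omega>"
    using ae' ae by eventually_elim simp
qed

lemma cond_exp_obs_mean:
  shows "integrable M (\<lambda>\<omega>. coord r (y k \<omega>))"
    and "AE \<omega> in M. real_cond_exp M (past k) (\<lambda>\<omega>. coord r (y k \<omega>)) \<omega> = mix_mean k r \<omega>"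
  unfolding mix_mean_def
  using cond_exp_state_sum[of "\<lambda>\<omega>. coord r (y k \<omega>)", OF coord_obs_measurable cond_exp_state_obs] by auto

lemma cond_exp_obs_second:
  shows "integrable M (\<lambda>\<omega>. coord r (y k \<omega>) * coord c (y k \<omega>))"
    and "AE \<omega> in M. real_cond_exp M (past k) (\<lambda>\<omega>. coord r (y k \<omega>) * coord c (y k \<omega>)) \<omega> =
      (\<Sum>i<n. second (ctrl k \<omega>) i r c * pred k i \<omega>)"
  using cond_exp_state_sum[of "\<lambda>\<omega>. coord r (y k \<omega>) * coord c (y k \<omega>)",
      OF borel_measurable_times[OF coord_obs_measurable coord_obs_measurable] cond_exp_state_obs_obs] by auto

lemma mix_mean_measurable_past: "mix_mean k r \<in> borel_measurable (past k)"
  unfolding mix_mean_def[abs_def]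
  by (intro borel_measurable_sum borel_measurable_times fun_ctrl_measurable_past pred_measurable_past)

lemma mix_mean_measurable [measurable]: "mix_mean k r \<in> borel_measurable M"
  by (rule measurable_from_subalg[OF subalgebra_obs_history mix_mean_measurable_past])

lemma pred_measurable [measurable]: "pred k i \<in> borel_measurable M"
  by (rule measurable_from_subalg[OF subalgebra_obs_history pred_measurable_past])

text \<open>With finitely many controls the sum over \<open>U\<close> is a deterministic bound, as
  \<open>real_cond_exp_centered_mult\<close> demands.\<close>

lemma mix_mean_bound: "AE \<omega> in M. \<bar>mix_mean k r \<omega>\<bar> \<le> (\<Sum>i<n. \<Sum>a\<in>U. \<bar>mean a i r\<bar>)"
proof -
  have "AE \<omega> in M. \<forall>i\<in>{..<n}. \<bar>pred k i \<omega>\<bar> \<le> 1"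
    using pred_bound by (intro AE_finite_allI) auto
  then show ?thesis using AE_space
  proof eventually_elim
    case (elim \<omega>)
    have "\<bar>mix_mean k r \<omega>\<bar> \<le> (\<Sum>i<n. \<bar>mean (ctrl k \<omega>) i r * pred k i \<omega>\<bar>)"
      unfolding mix_mean_def by (rule sum_abs)
    also have "\<dots> \<le> (\<Sum>i<n. \<Sum>a\<in>U. \<bar>mean a i r\<bar>)"
    proof (rule sum_mono)
      fix i assume "i \<in> {..<n}"
      then have "\<bar>mean (ctrl k \<omega>) i r * pred k i \<omega>\<bar> \<le> \<bar>mean (ctrl k \<omega>) i r\<bar> * 1"
        unfolding abs_mult using elim by (intro mult_left_mono) auto
      also have "\<dots> \<le> (\<Sum>a\<in>U. \<bar>mean a i r\<bar>)"
        using member_le_sum[of "ctrl k \<omega>" U "\<lambda>a. \<bar>mean a i r\<bar>"] finite_controls ctrl_in elim by simp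
      finally show "\<bar>mean (ctrl k \<omega>) i r * pred k i \<omega>\<bar> \<le> (\<Sum>a\<in>U. \<bar>mean a i r\<bar>)" .
    qed
    finally show ?case .
  qed
qed

section \<open>State prediction and its error covariance\<close>

lemma state_est_past:
  "\<omega> \<in> space M \<Longrightarrow> state_est M x y u k (int k - 1) \<omega> = vec n (\<lambda>i. pred k i \<omega>)"
  by (simp add: state_est_def vec_cond_exp_coord state_dim pred_def)

text \<open>Coordinates of the state are indicators of disjoint events: products vanish off the
  diagonal and are idempotent on it.\<close>

lemma cond_exp_state_cov:
  assumes i: "i < n" and j: "j < n"
  shows "AE \<omega> in M. real_cond_exp M (past k)
      (\<lambda>\<omega>. (coord i (x k \<omega>) - pred k i \<omega>) * (coord j (x k \<omega>) - pred k j \<omega>)) \<omega> =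
    (if i = j then pred k i \<omega> else 0) - pred k i \<omega> * pred k j \<omega>"
proof -
  interpret F: sigma_finite_subalgebra M "past k" by (rule obs_history_sigma_finite)
  have eq: "coord i (x k \<omega>) * coord j (x k \<omega>) = (if i = j then coord i (x k \<omega>) else 0)" if "\<omega> \<in> space M" for \<omega>
    using coord_state[OF that i, of k] coord_state[OF that j, of k] i j by auto
  have int: "integrable M (\<lambda>\<omega>. coord i (x k \<omega>) * coord j (x k \<omega>))"
    by (subst Bochner_Integration.integrable_cong[OF refl eq]) (simp, cases "i = j", simp_all)
  have ae: "AE \<omega> in M. real_cond_exp M (past k) (\<lambda>\<omega>. coord i (x k \<omega>)) \<omega> = pred k i \<omega>" for i
    by (simp add: pred_def)
  have "AE \<omega> in M. real_cond_exp M (past k) (\<lambda>\<omega>. coord i (x k \<omega>) * coord j (x k \<omega>)) \<omega> =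
      real_cond_exp M (past k) (\<lambda>\<omega>. if i = j then coord i (x k \<omega>) else 0) \<omega>"
    by (rule cond_exp_cong_space[OF eq _ subalgebra_obs_history]) auto
  moreover have "AE \<omega> in M. real_cond_exp M (past k) (\<lambda>\<omega>. 0) \<omega> = 0"
    by (rule F.real_cond_exp_F_meas) auto
  ultimately show ?thesis
    using real_cond_exp_centered_mult(2)[OF subalgebra_obs_history coord_state_integrable coord_state_integrable int
        pred_measurable_past pred_measurable_past ae ae pred_bound[OF i] pred_bound[OF j]]
    by eventually_elim (simp add: pred_def)
qed

lemma pred_cov_eq: "AE \<omega> in M. pred_cov M x y u k \<omega> = categorical_cov n (\<lambda>i. pred k i \<omega>)"
proof -
  define E where "E \<omega> = x k \<omega> - state_est M x y u k (int k - 1) \<omega>" for \<omega>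
  \<comment> \<open>Literally the padded entry conditioned inside \<open>mat_cond_exp\<close>, so
    that unfolding the definition produces \<open>f\<close>.\<close>
  define f where "f i j \<omega> = (if i < dim_row (outer_prod (E \<omega>) (E \<omega>)) \<and> j < dim_col (outer_prod (E \<omega>) (E \<omega>))
      then outer_prod (E \<omega>) (E \<omega>) $$ (i, j) else 0)" for i j \<omega>
  have dim: "dim_vec (E \<omega>) = n" if "\<omega> \<in> space M" for \<omega>
    using that by (simp add: E_def state_est_past)
  have f: "f i j \<omega> = (coord i (x k \<omega>) - pred k i \<omega>) * (coord j (x k \<omega>) - pred k j \<omega>)"
    if "\<omega> \<in> space M" "i < n" "j < n" for i j \<omega>
    using that dim[OF that(1)] by (simp add: f_def outer_prod_def) (simp add: E_def state_est_past coord_def state_dim)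
  have "AE \<omega> in M. real_cond_exp M (past k) (f i j) \<omega> = (if i = j then pred k i \<omega> else 0) - pred k i \<omega> * pred k j \<omega>"
    if ij: "i < n" "j < n" for i j
  proof -
    have "AE \<omega> in M. real_cond_exp M (past k) (f i j) \<omega> = real_cond_exp M (past k)
        (\<lambda>\<omega>. (coord i (x k \<omega>) - pred k i \<omega>) * (coord j (x k \<omega>) - pred k j \<omega>)) \<omega>"
      by (rule cond_exp_cong_space[OF f[OF _ ij] _ subalgebra_obs_history]) measurable
    with cond_exp_state_cov[OF ij, of k] show ?thesis by eventually_elim simp
  qed
  then have "AE \<omega> in M. \<forall>i\<in>{..<n}. \<forall>j\<in>{..<n}. real_cond_exp M (past k) (f i j) \<omega> = (if i = j then pred k i \<omega> else 0) - pred k i \<omega> * pred k j \<omega>"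
    by (intro AE_finite_allI) auto
  then show ?thesis using AE_space
  proof eventually_elim
    case (elim \<omega>)
    have "pred_cov M x y u k \<omega> = mat n n (\<lambda>(i, j). real_cond_exp M (past k) (f i j) \<omega>)"
      unfolding pred_cov_def mat_cond_exp_def f_def E_def[symmetric]
      by (simp add: outer_prod_def dim elim)
    also have "\<dots> = categorical_cov n (\<lambda>i. pred k i \<omega>)"
      unfolding categorical_cov_def using elim by (intro eq_matI) auto
    finally show ?case .
  qed
qed

section \<open>Observation prediction and innovation covariance\<close>

lemma obs_pred_dim: "\<omega> \<in> space M \<Longrightarrow> dim_vec (obs_pred M y u k \<omega>) = d (ctrl k \<omega>)"
  by (simp add: obs_pred_def vec_cond_exp_coord obs_dim')

lemma obs_pred_eq:
  "AE \<omega> in M. obs_pred M y u k \<omega> = vec (d (ctrl k \<omega>)) (\<lambda>r. mix_mean k r \<omega>)"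
proof -
  have "AE \<omega> in M. \<forall>r. real_cond_exp M (past k) (\<lambda>\<omega>. coord r (y k \<omega>)) \<omega> = mix_mean k r \<omega>"
    using cond_exp_obs_mean(2) by (simp add: AE_all_countable)
  then show ?thesis using AE_space
    by eventually_elim (simp add: obs_pred_def vec_cond_exp_coord obs_dim')
qed

text \<open>Keeps the chosen version of the conditional expectation in place of
  \<open>mix_mean\<close>, so that \<open>obs_innov_eq\<close> holds at every point; the explicit
  mean enters later, almost everywhere.\<close>

definition obs_err :: "nat \<Rightarrow> nat \<Rightarrow> 'w \<Rightarrow> real" where
  "obs_err k r \<omega> = (if r < d (ctrl k \<omega>) then coord r (y k \<omega>) - real_cond_exp M (past k) (\<lambda>\<omega>. coord r (y k \<omega>)) \<omega> else 0)"

lemma obs_innov_eq: "\<omega> \<in> space M \<Longrightarrow> obs_innov M y u k \<omega> = vec (d (ctrl k \<omega>)) (\<lambda>r. obs_err k r \<omega>)"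
  by (rule eq_vecI) (auto simp: obs_innov_def obs_pred_dim obs_err_def obs_pred_def vec_cond_exp_coord obs_dim' coord_obs)

lemma obs_err_measurable [measurable]: "obs_err k r \<in> borel_measurable M"
proof -
  have [measurable]: "Measurable.pred M (\<lambda>\<omega>. r < d (ctrl k \<omega>))"
    using measurable_compose[OF ctrl_measurable, of "\<lambda>a. r < d a" "count_space UNIV" k] by simp
  show ?thesis unfolding obs_err_def[abs_def] by measurable
qed

text \<open>Beyond the current dimension \<open>coord\<close> and \<open>mix_mean\<close> both
  vanish, hence no restriction on \<open>r\<close>.\<close>

lemma obs_err_AE: "AE \<omega> in M. obs_err k r \<omega> = coord r (y k \<omega>) - mix_mean k r \<omega>"
  using cond_exp_obs_mean(2)[of k r] AE_space
  by eventually_elim (auto simp: obs_err_def mix_mean_def mean_def coord_obs)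

text \<open>Up to null sets the innovation is \<open>coord\<close> minus \<open>mix_mean\<close>, so
  centring reduces its covariance to the second moments of the observation.\<close>

lemma innov_cov_eq:
  "AE \<omega> in M. innov_cov M y u k \<omega> = mat (d (ctrl k \<omega>)) (d (ctrl k \<omega>))
     (\<lambda>(r, c). (\<Sum>i<n. second (ctrl k \<omega>) i r c * pred k i \<omega>) - mix_mean k r \<omega> * mix_mean k c \<omega>)"
proof -
  let ?E = "obs_innov M y u k"
  define f where "f r c \<omega> = (if r < dim_row (outer_prod (?E \<omega>) (?E \<omega>)) \<and> c < dim_col (outer_prod (?E \<omega>) (?E \<omega>))
      then outer_prod (?E \<omega>) (?E \<omega>) $$ (r, c) else 0)" for r c \<omega>
  interpret F: sigma_finite_subalgebra M "past k" by (rule obs_history_sigma_finite)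
  have f: "f r c \<omega> = obs_err k r \<omega> * obs_err k c \<omega>" if "\<omega> \<in> space M" for r c \<omega>
    using that by (simp add: f_def outer_prod_def obs_innov_eq) (simp add: obs_err_def)
  have "AE \<omega> in M. real_cond_exp M (past k) (f r c) \<omega> =
      (\<Sum>i<n. second (ctrl k \<omega>) i r c * pred k i \<omega>) - mix_mean k r \<omega> * mix_mean k c \<omega>" for r c
  proof -
    have "AE \<omega> in M. real_cond_exp M (past k) (f r c) \<omega> = real_cond_exp M (past k) (\<lambda>\<omega>. obs_err k r \<omega> * obs_err k c \<omega>) \<omega>"
      by (rule cond_exp_cong_space[OF f _ subalgebra_obs_history]) measurable
    moreover have "AE \<omega> in M. obs_err k r \<omega> * obs_err k c \<omega> =
        (coord r (y k \<omega>) - mix_mean k r \<omega>) * (coord c (y k \<omega>) - mix_mean k c \<omega>)"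
      using obs_err_AE[of k r] obs_err_AE[of k c] by eventually_elim simp
    then have "AE \<omega> in M. real_cond_exp M (past k) (\<lambda>\<omega>. obs_err k r \<omega> * obs_err k c \<omega>) \<omega> =
        real_cond_exp M (past k) (\<lambda>\<omega>. (coord r (y k \<omega>) - mix_mean k r \<omega>) * (coord c (y k \<omega>) - mix_mean k c \<omega>)) \<omega>"
      by (rule F.real_cond_exp_cong) measurable
    moreover note real_cond_exp_centered_mult(2)[OF subalgebra_obs_history cond_exp_obs_mean(1) cond_exp_obs_mean(1)
        cond_exp_obs_second(1) mix_mean_measurable_past mix_mean_measurable_past
        cond_exp_obs_mean(2) cond_exp_obs_mean(2) mix_mean_bound mix_mean_bound, of k r c]
    moreover note cond_exp_obs_second(2)[of k r c]
    ultimately show ?thesis by eventually_elim simp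
  qed
  then have "AE \<omega> in M. \<forall>r c. real_cond_exp M (past k) (f r c) \<omega> =
      (\<Sum>i<n. second (ctrl k \<omega>) i r c * pred k i \<omega>) - mix_mean k r \<omega> * mix_mean k c \<omega>"
    by (simp add: AE_all_countable)
  then show ?thesis using AE_space
  proof eventually_elim
    case (elim \<omega>)
    have "innov_cov M y u k \<omega> = mat (d (ctrl k \<omega>)) (d (ctrl k \<omega>)) (\<lambda>(r, c). real_cond_exp M (past k) (f r c) \<omega>)"
      unfolding innov_cov_def mat_cond_exp_def f_def
      by (simp add: outer_prod_def obs_innov_eq elim)
    then show ?case using elim by simp
  qed
qed

section \<open>Cross covariance of the two innovations\<close>

definition post :: "nat \<Rightarrow> nat \<Rightarrow> 'w \<Rightarrow> real" where
  "post k i = real_cond_exp M (present k) (\<lambda>\<omega>. coord i (x k \<omega>))"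

lemma state_innov_eq:
  "\<omega> \<in> space M \<Longrightarrow> state_innov M x y u k \<omega> = vec n (\<lambda>i. post k i \<omega> - pred k i \<omega>)"
  by (rule eq_vecI) (auto simp: state_innov_def state_est_past state_est_def vec_cond_exp_coord state_dim pred_def post_def)

lemma post_measurable [measurable]: "post k i \<in> borel_measurable M"
  unfolding post_def by measurable

text \<open>Since \<open>y\<^sub>k\<close> is \<open>\<F>\<^sub>k\<close>-measurable, the tower property turns \<open>p\<^bsub>k|k\<^esub>\<close> into \<open>x\<^sub>k\<close>.\<close>

lemma cond_exp_post_obs:
  assumes i: "i < n"
  shows "integrable M (\<lambda>\<omega>. post k i \<omega> * coord c (y k \<omega>))"
    and "AE \<omega> in M. real_cond_exp M (past k) (\<lambda>\<omega>. post k i \<omega> * coord c (y k \<omega>)) \<omega> = mean (ctrl k \<omega>) i c * pred k i \<omega>"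
proof -
  interpret F: sigma_finite_subalgebra M "past k" by (rule obs_history_sigma_finite)
  interpret G: sigma_finite_subalgebra M "present k" by (rule obs_history_sigma_finite)
  have y: "(\<lambda>\<omega>. coord c (y k \<omega>)) \<in> borel_measurable (present k)"
    by (rule measurable_compose[OF obs_measurable_obs_history]) auto
  have int: "integrable M (\<lambda>\<omega>. coord c (y k \<omega>) * coord i (x k \<omega>))"
    using cond_exp_state_obs(1)[OF i, of k c] by (simp add: mult.commute)
  show "integrable M (\<lambda>\<omega>. post k i \<omega> * coord c (y k \<omega>))"
    using G.real_cond_exp_intg(1)[OF int y] by (simp add: post_def mult.commute)
  have "AE \<omega> in M. real_cond_exp M (present k) (\<lambda>\<omega>. coord c (y k \<omega>) * coord i (x k \<omega>)) \<omega> = coord c (y k \<omega>) * post k i \<omega>"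
    unfolding post_def by (rule G.real_cond_exp_mult[OF y _ int]) simp
  then have "AE \<omega> in M. real_cond_exp M (past k) (real_cond_exp M (present k) (\<lambda>\<omega>. coord c (y k \<omega>) * coord i (x k \<omega>))) \<omega> =
      real_cond_exp M (past k) (\<lambda>\<omega>. coord c (y k \<omega>) * post k i \<omega>) \<omega>"
    by (rule F.real_cond_exp_cong) measurable
  moreover have "AE \<omega> in M. real_cond_exp M (past k) (real_cond_exp M (present k) (\<lambda>\<omega>. coord c (y k \<omega>) * coord i (x k \<omega>))) \<omega> =
      real_cond_exp M (past k) (\<lambda>\<omega>. coord c (y k \<omega>) * coord i (x k \<omega>)) \<omega>"
    by (rule F.real_cond_exp_nested_subalg[OF subalgebra_obs_history subalgebra_obs_obs int]) simp
  moreover note cond_exp_state_obs(2)[OF i, of k c]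
  ultimately show "AE \<omega> in M. real_cond_exp M (past k) (\<lambda>\<omega>. post k i \<omega> * coord c (y k \<omega>)) \<omega> = mean (ctrl k \<omega>) i c * pred k i \<omega>"
    by eventually_elim (simp add: mult.commute)
qed

text \<open>Centring applied to \<open>post\<close> and the observation: by the tower property
  \<open>post\<close> has conditional mean \<open>pred\<close>, and its product with the observation
  has the conditional mean already known for the state itself.\<close>

lemma cross_cov_eq:
  "AE \<omega> in M. mat_cond_exp M (past k) (\<lambda>\<omega>. outer_prod (state_innov M x y u k \<omega>) (obs_innov M y u k \<omega>)) \<omega> =
     mat n (d (ctrl k \<omega>)) (\<lambda>(i, c). mean (ctrl k \<omega>) i c * pred k i \<omega> - pred k i \<omega> * mix_mean k c \<omega>)"
proof -
  let ?S = "state_innov M x y u k" and ?E = "obs_innov M y u k"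
  define f where "f i c \<omega> = (if i < dim_row (outer_prod (?S \<omega>) (?E \<omega>)) \<and> c < dim_col (outer_prod (?S \<omega>) (?E \<omega>))
      then outer_prod (?S \<omega>) (?E \<omega>) $$ (i, c) else 0)" for i c \<omega>
  interpret F: sigma_finite_subalgebra M "past k" by (rule obs_history_sigma_finite)
  interpret G: sigma_finite_subalgebra M "present k" by (rule obs_history_sigma_finite)
  have f: "f i c \<omega> = (post k i \<omega> - pred k i \<omega>) * obs_err k c \<omega>" if "\<omega> \<in> space M" "i < n" for i c \<omega>
    using that by (simp add: f_def outer_prod_def obs_innov_eq state_innov_eq) (simp add: obs_err_def)
  have "AE \<omega> in M. real_cond_exp M (past k) (f i c) \<omega> = mean (ctrl k \<omega>) i c * pred k i \<omega> - pred k i \<omega> * mix_mean k c \<omega>"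
    if i: "i < n" for i c
  proof -
    have "AE \<omega> in M. real_cond_exp M (past k) (f i c) \<omega> = real_cond_exp M (past k) (\<lambda>\<omega>. (post k i \<omega> - pred k i \<omega>) * obs_err k c \<omega>) \<omega>"
      by (rule cond_exp_cong_space[OF f[OF _ i] _ subalgebra_obs_history]) measurable
    moreover have "AE \<omega> in M. (post k i \<omega> - pred k i \<omega>) * obs_err k c \<omega> =
        (post k i \<omega> - pred k i \<omega>) * (coord c (y k \<omega>) - mix_mean k c \<omega>)"
      using obs_err_AE[of k c] by eventually_elim simp
    then have "AE \<omega> in M. real_cond_exp M (past k) (\<lambda>\<omega>. (post k i \<omega> - pred k i \<omega>) * obs_err k c \<omega>) \<omega> =
        real_cond_exp M (past k) (\<lambda>\<omega>. (post k i \<omega> - pred k i \<omega>) * (coord c (y k \<omega>) - mix_mean k c \<omega>)) \<omega>"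
      by (rule F.real_cond_exp_cong) measurable
    moreover have int: "integrable M (post k i)"
      unfolding post_def by (rule G.real_cond_exp_int) simp
    have "AE \<omega> in M. real_cond_exp M (past k) (post k i) \<omega> = pred k i \<omega>"
      unfolding post_def pred_def
      by (rule F.real_cond_exp_nested_subalg[OF subalgebra_obs_history subalgebra_obs_obs]) auto
    note real_cond_exp_centered_mult(2)[OF subalgebra_obs_history int cond_exp_obs_mean(1)
        cond_exp_post_obs(1)[OF i] pred_measurable_past mix_mean_measurable_past this
        cond_exp_obs_mean(2) pred_bound[OF i] mix_mean_bound, of c]
    moreover note cond_exp_post_obs(2)[OF i, of k c]
    ultimately show ?thesis by eventually_elim simp
  qed
  then have "AE \<omega> in M. \<forall>i\<in>{..<n}. \<forall>c. real_cond_exp M (past k) (f i c) \<omega> =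
      mean (ctrl k \<omega>) i c * pred k i \<omega> - pred k i \<omega> * mix_mean k c \<omega>"
    by (intro AE_finite_allI) (auto simp: AE_all_countable)
  then show ?thesis using AE_space
  proof eventually_elim
    case (elim \<omega>)
    have "mat_cond_exp M (past k) (\<lambda>\<omega>. outer_prod (?S \<omega>) (?E \<omega>)) \<omega> =
        mat n (d (ctrl k \<omega>)) (\<lambda>(i, c). real_cond_exp M (past k) (f i c) \<omega>)"
      unfolding mat_cond_exp_def f_def
      by (simp add: outer_prod_def obs_innov_eq state_innov_eq elim)
    also have "\<dots> = mat n (d (ctrl k \<omega>)) (\<lambda>(i, c). mean (ctrl k \<omega>) i c * pred k i \<omega> - pred k i \<omega> * mix_mean k c \<omega>)"
      using elim by (intro eq_matI) auto
    finally show ?case .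
  qed
qed

end

section \<open>Recursion and gain\<close>

context controlled_pomc
begin

text \<open>Measurability with respect to the trivial sigma-algebra forces a constant, which must be
  the expectation. Hence the equation holds at every point, not only almost surely.\<close>

lemma pred_initial:
  assumes \<omega>: "\<omega> \<in> space M" and i: "i < n"
  shows "pred 0 i \<omega> = \<pi> $ i"
proof -
  interpret F: sigma_finite_subalgebra M "past 0" by (rule obs_history_sigma_finite)
  have sets: "sets (past 0) = {{}, space M}"
    unfolding sets_obs_history by (simp add: sigma_sets_empty_eq)
  have const: "pred 0 i \<omega>' = pred 0 i \<omega>" if "\<omega>' \<in> space M" for \<omega>'
  proof -
    \<comment> \<open>A level set containing \<open>\<omega>\<close> is nonempty, so only the whole
      space is left.\<close>
    have "pred 0 i -` {pred 0 i \<omega>} \<inter> space (past 0) \<in> sets (past 0)"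
      by (rule measurable_sets[OF pred_measurable_past]) simp
    with \<omega> have "pred 0 i -` {pred 0 i \<omega>} \<inter> space M = space M"
      unfolding sets space_histories by blast
    then show ?thesis using that by blast
  qed
  have "pred 0 i \<omega> = (\<integral>\<omega>'. pred 0 i \<omega> \<partial>M)" by (simp add: prob_space)
  also have "\<dots> = (\<integral>\<omega>'. pred 0 i \<omega>' \<partial>M)"
    using const by (intro Bochner_Integration.integral_cong) auto
  also have "\<dots> = (\<integral>\<omega>'. coord i (x 0 \<omega>') \<partial>M)"
    unfolding pred_def by (rule F.real_cond_exp_int(2)) simp
  also have "\<dots> = (\<integral>\<omega>'. indicat_real {\<omega> \<in> space M. x 0 \<omega> = unit_vec n i} \<omega>' \<partial>M)"
    using i by (intro Bochner_Integration.integral_cong) (auto simp: coord_state)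
  also have "\<dots> = prob {\<omega> \<in> space M. x 0 \<omega> = unit_vec n i}"
    by (simp add: Int_absorb2 subset_eq)
  finally show ?thesis using init_law[OF i] by simp
qed

lemma state_est_initial: "\<omega> \<in> space M \<Longrightarrow> state_est M x y u 0 (- 1) \<omega> = \<pi>"
  using state_est_past[of \<omega> 0] init_carrier pred_initial by (intro eq_vecI) auto

text \<open>Tower property through the joint history up to time \<open>j\<close>, where
  \<open>transition\<close> gives the conditional mean as a linear function of the current state;
  conditioning down to \<open>present j\<close> keeps it linear.\<close>

lemma pred_Suc:
  assumes i: "i < n"
  shows "AE \<omega> in M. pred (Suc j) i \<omega> = (\<Sum>l<n. P $$ (i, l) * post j l \<omega>)"
proof -
  let ?K = "history M x y u (int j) (int j) (int j)"
  interpret F: sigma_finite_subalgebra M "present j" by (rule obs_history_sigma_finite)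
  interpret K: sigma_finite_subalgebra M ?K by (rule history_sigma_finite)
  \<comment> \<open>Predicting time j+1 and estimating at time j use the same observations, as
    (j+1)-1 = j.\<close>
  have past: "past (Suc j) = present j" by simp
  have "AE \<omega> in M. real_cond_exp M ?K (\<lambda>\<omega>. coord i (x (Suc j) \<omega>)) \<omega> = (\<Sum>l<n. P $$ (i, l) * coord l (x j \<omega>))"
    using transition[of j] AE_space
  proof eventually_elim
    case (elim \<omega>)
    then have "real_cond_exp M ?K (\<lambda>\<omega>. coord i (x (Suc j) \<omega>)) \<omega> = (P *\<^sub>v x j \<omega>) $ i"
      using i by (metis index_vec state_dim vec_cond_exp_coord)
    also have "\<dots> = (\<Sum>l<n. P $$ (i, l) * coord l (x j \<omega>))"
      using i trans_carrier elim(2) by (simp add: scalar_prod_def atLeast0LessThan state_dim coord_def)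
    finally show ?case .
  qed
  then have "AE \<omega> in M. real_cond_exp M (present j) (real_cond_exp M ?K (\<lambda>\<omega>. coord i (x (Suc j) \<omega>))) \<omega> =
      real_cond_exp M (present j) (\<lambda>\<omega>. \<Sum>l<n. P $$ (i, l) * coord l (x j \<omega>)) \<omega>"
    by (rule F.real_cond_exp_cong) measurable
  moreover have "AE \<omega> in M. real_cond_exp M (present j) (real_cond_exp M ?K (\<lambda>\<omega>. coord i (x (Suc j) \<omega>))) \<omega> =
      real_cond_exp M (present j) (\<lambda>\<omega>. coord i (x (Suc j) \<omega>)) \<omega>"
    by (rule F.real_cond_exp_nested_subalg[OF subalgebra_history subalgebra_history_obs coord_state_integrable]) auto
  moreover have "AE \<omega> in M. real_cond_exp M (present j) (\<lambda>\<omega>. \<Sum>l<n. P $$ (i, l) * coord l (x j \<omega>)) \<omega> =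
      (\<Sum>l<n. real_cond_exp M (present j) (\<lambda>\<omega>. P $$ (i, l) * coord l (x j \<omega>)) \<omega>)"
    by (rule F.real_cond_exp_sum) simp
  moreover have "AE \<omega> in M. \<forall>l. real_cond_exp M (present j) (\<lambda>\<omega>. P $$ (i, l) * coord l (x j \<omega>)) \<omega> = P $$ (i, l) * post j l \<omega>"
    unfolding AE_all_countable post_def by (intro allI F.real_cond_exp_cmult coord_state_integrable)
  ultimately show ?thesis
    unfolding pred_def past by eventually_elim simp
qed

lemma state_est_present:
  "\<omega> \<in> space M \<Longrightarrow> state_est M x y u k (int k) \<omega> = vec n (\<lambda>i. post k i \<omega>)"
  by (simp add: state_est_def vec_cond_exp_coord state_dim post_def)

lemma state_est_Suc:
  "AE \<omega> in M. state_est M x y u (Suc j) (int (Suc j) - 1) \<omega> = P *\<^sub>v state_est M x y u j (int j) \<omega>"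
proof -
  have "AE \<omega> in M. \<forall>i\<in>{..<n}. pred (Suc j) i \<omega> = (\<Sum>l<n. P $$ (i, l) * post j l \<omega>)"
    using pred_Suc by (intro AE_finite_allI) auto
  then show ?thesis using AE_space
  proof eventually_elim
    case (elim \<omega>)
    show ?case
      unfolding state_est_past[OF elim(2)] state_est_present[OF elim(2)]
      using elim(1) trans_carrier by (intro eq_vecI) (auto simp: scalar_prod_def atLeast0LessThan)
  qed
qed

lemma obs_pred_mean_mat:
  "AE \<omega> in M. obs_pred M y u k \<omega> = mean_mat n d m (ctrl k \<omega>) *\<^sub>v state_est M x y u k (int k - 1) \<omega>"
  using obs_pred_eq[of k] AE_space
proof eventually_elim
  case (elim \<omega>)
  then show ?case
    by (simp only: state_est_past mean_mat_mult_vec) (intro eq_vecI, auto simp: mix_mean_def mean_def)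
qed

text \<open>The closed form claimed for the innovation covariance, kept apart from
  \<open>innov_cov\<close> until \<open>gain_formula\<close> identifies the two almost
  surely.\<close>

definition innov_mat :: "nat \<Rightarrow> 'w \<Rightarrow> real mat" where
  "innov_mat k \<omega> = mean_mat n d m (ctrl k \<omega>) * pred_cov M x y u k \<omega> * transpose_mat (mean_mat n d m (ctrl k \<omega>)) +
     mix_cov n d Q (state_est M x y u k (int k - 1) \<omega>) (ctrl k \<omega>)"

text \<open>Once the almost sure identities are intersected, matrix algebra at a single point
  remains. \<open>innov_cov\<close> and \<open>innov_mat\<close> are the same mixture covariance,
  whose positivity makes both \<open>mat_inv\<close> genuine inverses.\<close>

lemma gain_formula:
  "AE \<omega> in M. invertible_mat (innov_cov M y u k \<omega>) \<and> invertible_mat (innov_mat k \<omega>) \<and>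
     gain M x y u k \<omega> = pred_cov M x y u k \<omega> * transpose_mat (mean_mat n d m (ctrl k \<omega>)) * mat_inv (innov_mat k \<omega>)"
proof -
  have "AE \<omega> in M. \<forall>i. 0 \<le> pred k i \<omega>" using pred_nonneg by (simp add: AE_all_countable)
  with innov_cov_eq[of k] cross_cov_eq[of k] pred_cov_eq[of k] pred_sum[of k] AE_space show ?thesis
  proof eventually_elim
    case (elim \<omega>)
    let ?a = "ctrl k \<omega>" and ?p = "\<lambda>i. pred k i \<omega>"
    note innov = elim(1) and cross = elim(2) and cov = elim(3)
    have a: "?a \<in> U" using ctrl_in elim(5) .
    have mm: "mix_mean k r \<omega> = (\<Sum>i<n. m ?a i $ r * ?p i)" if "r < d ?a" for r
      using that by (simp add: mix_mean_def mean_def)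
    have S: "innov_mat k \<omega> = mat (d ?a) (d ?a) (\<lambda>(r, c). (\<Sum>i<n. (Q ?a i $$ (r, c) + m ?a i $ r * m ?a i $ c) * ?p i) -
       (\<Sum>i<n. m ?a i $ r * ?p i) * (\<Sum>i<n. m ?a i $ c * ?p i))"
      unfolding innov_mat_def cov state_est_past[OF elim(5)] by (rule mixture_cov_eq)
    have eq: "innov_cov M y u k \<omega> = innov_mat k \<omega>"
      unfolding innov S by (rule eq_matI) (auto simp: mm second_def)
    have inv: "invertible_mat (innov_mat k \<omega>)"
    proof (rule invertible_mat_if_positive)
      show "innov_mat k \<omega> \<in> carrier_mat (d ?a) (d ?a)" unfolding S by simp
      fix v :: "nat \<Rightarrow> real" assume v: "\<exists>i<d ?a. v i \<noteq> 0"
      \<comment> \<open>Almost surely the predicted probabilities are nonnegative and sum to one, so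
        they are admissible mixture weights.\<close>
      have "0 < (\<Sum>r<d ?a. \<Sum>c<d ?a. v r * ((\<Sum>i<n. (Q ?a i $$ (r, c) + m ?a i $ r * m ?a i $ c) * ?p i) -
          (\<Sum>i<n. m ?a i $ r * ?p i) * (\<Sum>i<n. m ?a i $ c * ?p i)) * v c)"
        using elim(4,6) by (intro mixture_cov_positive pos_def_mat_quadratic_form[OF cov_pos_def[OF a] v]) auto
      then show "0 < (\<Sum>i<d ?a. \<Sum>j<d ?a. v i * innov_mat k \<omega> $$ (i, j) * v j)"
        unfolding S by simp
    qed
    have "mat_cond_exp M (past k) (\<lambda>\<omega>. outer_prod (state_innov M x y u k \<omega>) (obs_innov M y u k \<omega>)) \<omega> =
        pred_cov M x y u k \<omega> * transpose_mat (mean_mat n d m ?a)"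
      unfolding cross cov categorical_cov_mult_mean_mat by (rule eq_matI) (auto simp: mm mean_def)
    then show ?case using inv by (simp add: gain_def eq)
  qed
qed

lemma state_est_recursion:
  assumes "AE \<omega> in M. state_innov M x y u k \<omega> = gain M x y u k \<omega> *\<^sub>v obs_innov M y u k \<omega>"
  shows "AE \<omega> in M. state_est M x y u k (int k) \<omega> =
    state_est M x y u k (int k - 1) \<omega> + gain M x y u k \<omega> *\<^sub>v (y k \<omega> - obs_pred M y u k \<omega>)"
  using assms AE_space
proof eventually_elim
  case (elim \<omega>)
  have "state_est M x y u k (int k) \<omega> =
      state_est M x y u k (int k - 1) \<omega> + state_innov M x y u k \<omega>"
    unfolding state_innov_def state_est_past[OF elim(2)] state_est_present[OF elim(2)]
    by (rule eq_vecI) auto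
  then show ?case using elim(1) by (simp add: obs_innov_def)
qed

text \<open>Substitutes the formulas for prediction, gain and predicted observation into
  \<open>state_est_recursion\<close>. Only the prediction needs a case split, since no estimate
  precedes time zero.\<close>

lemma state_est_recursion_explicit:
  assumes "AE \<omega> in M. state_innov M x y u k \<omega> = gain M x y u k \<omega> *\<^sub>v obs_innov M y u k \<omega>"
    and p': "p' = (\<lambda>\<omega>. if k = 0 then \<pi> else P *\<^sub>v state_est M x y u (k - 1) (int (k - 1)) \<omega>)"
  shows "AE \<omega> in M. state_est M x y u k (int k) \<omega> =
    p' \<omega> + (pred_cov M x y u k \<omega> * transpose_mat (mean_mat n d m (ctrl k \<omega>)) * mat_inv (innov_mat k \<omega>)) *\<^sub>v
      (y k \<omega> - mean_mat n d m (ctrl k \<omega>) *\<^sub>v p' \<omega>)"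
proof -
  have "AE \<omega> in M. state_est M x y u k (int k - 1) \<omega> = p' \<omega>"
  proof (cases k)
    case 0
    then show ?thesis using state_est_initial by (simp add: p')
  next
    case (Suc j)
    then show ?thesis using state_est_Suc[of j] by (simp add: p')
  qed
  with state_est_recursion[OF assms(1)] gain_formula[of k] obs_pred_mean_mat[of k]
  show ?thesis by eventually_elim simp
qed

end

theorem theorem2:
  fixes M :: "'w measure" and n :: nat and P :: "real mat" and \<pi> :: "real vec"
    and U :: "'u set" and u0 :: 'u
    and d :: "'u \<Rightarrow> nat" and m :: "'u \<Rightarrow> nat \<Rightarrow> real vec" and Q :: "'u \<Rightarrow> nat \<Rightarrow> real mat"
    and \<eta> :: "nat \<Rightarrow> (nat \<Rightarrow> real vec) \<times> (nat \<Rightarrow> 'u) \<Rightarrow> 'u"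
    and x y :: "nat \<Rightarrow> 'w \<Rightarrow> real vec" and u :: "nat \<Rightarrow> 'w \<Rightarrow> 'u"
  assumes model: "controlled_pomc M n P \<pi> U u0 d m Q \<eta> x y u"
  shows
    "let p = state_est M x y u;
         \<Sigma> = pred_cov M x y u;
         G = gain M x y u;
         \<M> = (\<lambda>k \<omega>. mean_mat n d m (prev_control u0 u k \<omega>));
         Qt = (\<lambda>k \<omega>. mix_cov n d Q (p k (int k - 1) \<omega>) (prev_control u0 u k \<omega>));
         S = (\<lambda>k \<omega>. \<M> k \<omega> * \<Sigma> k \<omega> * transpose_mat (\<M> k \<omega>) + Qt k \<omega>);
         G' = (\<lambda>k \<omega>. \<Sigma> k \<omega> * transpose_mat (\<M> k \<omega>) * mat_inv (S k \<omega>));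
         p' = (\<lambda>k \<omega>. if k = 0 then \<pi> else P *\<^sub>v p (k - 1) (int (k - 1)) \<omega>)
     in
       (\<forall>\<omega>\<in>space M. p 0 (- 1) \<omega> = \<pi>) \<and>
       (\<forall>k\<ge>1. AE \<omega> in M. p k (int k - 1) \<omega> = P *\<^sub>v p (k - 1) (int (k - 1)) \<omega>) \<and>
       (\<forall>k. AE \<omega> in M. obs_pred M y u k \<omega> = \<M> k \<omega> *\<^sub>v p k (int k - 1) \<omega>) \<and>
       (\<forall>k. AE \<omega> in M. invertible_mat (innov_cov M y u k \<omega>) \<and> invertible_mat (S k \<omega>) \<and>
              G k \<omega> = G' k \<omega>) \<and>
       (\<forall>k. (AE \<omega> in M. state_innov M x y u k \<omega> = G k \<omega> *\<^sub>v obs_innov M y u k \<omega>) \<longrightarrow>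
              (AE \<omega> in M. p k (int k) \<omega> =
                 p k (int k - 1) \<omega> + G k \<omega> *\<^sub>v (y k \<omega> - obs_pred M y u k \<omega>)) \<and>
              (AE \<omega> in M. p k (int k) \<omega> =
                 p' k \<omega> + G' k \<omega> *\<^sub>v (y k \<omega> - \<M> k \<omega> *\<^sub>v p' k \<omega>)))"
proof -
  interpret controlled_pomc M n P \<pi> U u0 d m Q \<eta> x y u by (rule model)
  have "AE \<omega> in M. state_est M x y u k (int k - 1) \<omega> = P *\<^sub>v state_est M x y u (k - 1) (int (k - 1)) \<omega>"
    if "k \<ge> 1" for k
    using that state_est_Suc[of "k - 1"] by simp
  then show ?thesis
    unfolding Let_def
    using state_est_initial obs_pred_mean_mat gain_formula[unfolded innov_mat_def]
      state_est_recursion state_est_recursion_explicit[unfolded innov_mat_def, OF _ refl]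
    by blast
qed

end
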